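(* Let $r>0$, and let the nominal distribution $\mu_0$ on $\mathbb{R}^{N(n+p)}$ be absolutely continuous with respect to Lebesgue measure with $\mathbb{E}_{\mu_0}\left[\begin{bmatrix} w\\ v\end{bmatrix}\begin{bmatrix} w^T & v^T\end{bmatrix}\right]=I$. With all other notation as in the context, the value of the distributionally robust regret-optimal control problem with measurement feedback, $$\inf_{K\in\mathcal{K}}\ \sup_{\mu\in\mathcal{P}}\ \mathbb{E}_{\mu}[R(K,w,v)],$$ equals the value of $$\inf_{Y\in\mathcal{K},\ \gamma>0,\ X\succeq 0}\ \gamma\,(r^2-N(n+p))+\operatorname{Tr}(X)$$ subject to $$\begin{bmatrix} X_{11} & X_{12} & \gamma I & 0 & 0\\ X_{12}^T & X_{22} & 0 & \gamma I & 0\\ \gamma I & 0 & \gamma I & -P\,\Xi & 0\\ 0 & \gamma I & -\Xi^T P^T & \gamma I & \Xi^T\\ 0 & 0 & 0 & \Xi & I\end{bmatrix}\succeq 0,\qquad \Xi = M_\gamma^{-1}Y+H_\gamma,$$ $$\begin{bmatrix} I & (Y-W_{-,\gamma})^T\\ Y-W_{-,\gamma} & I\end{bmatrix}\succ 0 .$$ Here $X=\begin{bmatrix} X_{11}&X_{12}\\ X_{12}^T&X_{22}\end{bmatrix}$ is symmetric with $X_{11}\in\mathbb{R}^{Nn\times Nn}$, $X_{12}\in\mathbb{R}^{Nn\times Np}$ and $X_{22}\in\mathbb{R}^{Np\times Np}$. Moreover, the optimal controller is obtained from an optimal solution $(Y^\ast,\gamma^\ast,X^\ast)$ of the latter problem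 as $$K^\ast=(I+E^\ast J)^{-1}E^\ast,\qquad E^\ast=T^{-\frac12}M_{\gamma^\ast}^{-1}\,(Y^\ast+W_{+,\gamma^\ast})\,U^{-\frac12},$$ that is, $K^\ast\in\mathcal{K}$ attains the infimum over $\mathcal{K}$ in the former problem.
   Context: **System.** Let $N,n,m,p\ge 1$ be integers. Consider the discrete-time linear time-invariant system $x_{t+1}=Ax_t+Bu_t+w_t$, $y_t=Cx_t+v_t$, with $x_0=0$, $x_t,w_t\in\mathbb{R}^n$, $u_t\in\mathbb{R}^m$, $y_t,v_t\in\mathbb{R}^p$, over the horizon $t=0,\dots,N-1$. Stack the signals into $x,w\in\mathbb{R}^{Nn}$, $u\in\mathbb{R}^{Nm}$, $y,v\in\mathbb{R}^{Np}$. The quadratic cost $x^TQx+u^TRu$, with $Q,R\succ0$, is normalized by replacing $x$ with $Q^{1/2}x$ and $u$ with $R^{1/2}u$, so that it becomes $\|x\|^2+\|u\|^2$. In these normalized variables the system is written $$x=Fu+Gw,\qquad y=Ju+Lw+v,$$ where $F\in\mathbb{R}^{Nn\times Nm}$, $G\in\mathbb{R}^{Nn\times Nn}$, $J\in\mathbb{R}^{Np\times Nm}$, $L\in\mathbb{R}^{Np\times Nn}$ are strictly causal time-invariant operators, i.e. strictly lower block triangular block Toeplitz matrices. **Controllers.** $\mathcal{K}\subseteq\mathbb{R}^{Nm\times Np}$ is the space of causal, i.e. lower block triangular, matrices (blocks of size $m\times p$, diagonal blocks allowed to be nonzero). A controller is $u=Ky$ with $K\in\mathcal{K}$. Put $E=K(I-JK)^{-1}$,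 equivalently $K=(I+EJ)^{-1}E$, and define $$T_K=\begin{bmatrix} FEL+G & FE\\ EL & E\end{bmatrix},$$ which maps $\begin{bmatrix} w\\ v\end{bmatrix}$ to $\begin{bmatrix} x\\ u\end{bmatrix}$ in closed loop. **Benchmark and regret.** Let $T=I+F^TF$, $U=I+LL^T$, $V=I+L^TL$, and $E_0=-T^{-1}F^TGL^TU^{-1}$. The benchmark noncausal controller $K_0$ (formally $K_0=(I+E_0J)^{-1}E_0$) has the closed-loop operator $$T_{K_0}=\begin{bmatrix} FE_0L+G & FE_0\\ E_0L & E_0\end{bmatrix}.$$ The regret of $K\in\mathcal{K}$ is $$R(K,w,v)=\begin{bmatrix} w^T & v^T\end{bmatrix}\left(T_K^TT_K-T_{K_0}^TT_{K_0}\right)\begin{bmatrix} w\\ v\end{bmatrix}.$$ **Ambiguity set.** $\mathcal{P}$ is the set of probability distributions $\mu$ on $\mathbb{R}^{N(n+p)}$ with $W_2(\mu_0,\mu)\le r$, where $W_2$ is the type-2 Wasserstein distance $$W_2^2(\mu_1,\mu_2)=\inf_{\pi\in\Pi(\mu_1,\mu_2)}\int\|z_1-z_2\|^2\,\pi(dz_1,dz_2),$$ $\Pi(\mu_1,\mu_2)$ is the set of joint distributions with marginals $\mu_1,\mu_2$, and $\|\cdot\|$ is the Euclidean norm. $\mathbb{E}_\mu$ denotes expectation when $\begin{bmatrix} w\\ v\end{bmatrix}\sim\mu$. **Factorizations.** $T^{1/2},U^{1/2},V^{1/2}$ are (block) lower triangular matrices with $T=T^{T/2}T^{1/2}$, $U=U^{1/2}U^{T/2}$,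 $V=V^{T/2}V^{1/2}$. Here the superscript $T/2$ denotes the transpose of the corresponding square-root factor, $-1/2$ its inverse, and $-T/2$ the inverse of its transpose. Define $$W=-T^{-\frac T2}F^TGL^TU^{-\frac T2}\in\mathbb{R}^{Nm\times Np},\qquad P=V^{-\frac T2}G^TFT^{-\frac12}\in\mathbb{R}^{Nn\times Nm}.$$ For $\gamma>0$, let $M_\gamma$ be the lower triangular matrix with positive diagonal such that $M_\gamma^TM_\gamma=\gamma^{-1}I+\gamma^{-2}P^TP$. Let $W_\gamma=M_\gamma W$, and write $W_\gamma=W_{+,\gamma}+W_{-,\gamma}$, where $W_{+,\gamma}\in\mathcal{K}$ is the causal (lower block triangular, including the block diagonal) part and $W_{-,\gamma}$ is the strictly anticausal (strictly upper block triangular) part. Finally, $$H_\gamma=M_\gamma^{-1}W_{+,\gamma}-W.$$ **Conventions.** $\succeq 0$ and $\succ 0$ denote positive semidefinite and positive definite symmetric matrices. Identity and zero blocks have the sizes dictated by conformity (in the $5\times5$ block matrix, the block sizes are $Nn,Np,Nn,Np,Nm$). *)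

theory Defs
  imports "HOL-Analysis.Analysis" "HOL-Probability.Probability"
begin

(* A signal with N blocks of size n is a vector indexed by 't \<times> 'n, where CARD('t) = N and
   CARD('n) = n; 't is linearly ordered and time_idx is its order isomorphism onto {0..N-1}. *)

definition time_idx :: "'t::{finite,linorder} \<Rightarrow> nat" where
  "time_idx t = card {s. s < t}"

definition signal_at :: "real^('t::finite \<times> 'n::finite) \<Rightarrow> 't \<Rightarrow> real^'n" where
  "signal_at x t = (\<chi> a. x $ (t, a))"

definition lti_trajectory ::
  "real^'n^'n \<Rightarrow> real^'m^'n \<Rightarrow> real^'n^'p \<Rightarrow>
   real^('t::{finite,linorder} \<times> 'n::finite) \<Rightarrow> real^('t \<times> 'm::finite) \<Rightarrow> real^('t \<times> 'n) \<Rightarrow>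
   real^('t \<times> 'p::finite) \<Rightarrow> real^('t \<times> 'p) \<Rightarrow> bool" where
  "lti_trajectory A B C x u w y v \<longleftrightarrow>
     (\<forall>t. time_idx t = 0 \<longrightarrow> signal_at x t = 0) \<and>
     (\<forall>s t. time_idx t = time_idx s + 1 \<longrightarrow>
        signal_at x t = A *v signal_at x s + B *v signal_at u s + signal_at w s) \<and>
     (\<forall>t. signal_at y t = C *v signal_at x t + signal_at v t)"

definition causal :: "real^('t::{finite,linorder} \<times> 'b::finite)^('t \<times> 'a::finite) \<Rightarrow> bool" where
  "causal A \<longleftrightarrow> (\<forall>i j a b. i < j \<longrightarrow> A $ (i, a) $ (j, b) = 0)"

definition strictly_causal ::
  "real^('t::{finite,linorder} \<times> 'b::finite)^('t \<times> 'a::finite) \<Rightarrow> bool" where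
  "strictly_causal A \<longleftrightarrow> (\<forall>i j a b. i \<le> j \<longrightarrow> A $ (i, a) $ (j, b) = 0)"

(* The premise says i - j = i' - j' for the positions of the blocks. *)
definition block_toeplitz ::
  "real^('t::{finite,linorder} \<times> 'b::finite)^('t \<times> 'a::finite) \<Rightarrow> bool" where
  "block_toeplitz A \<longleftrightarrow>
     (\<forall>i j i' j' a b. time_idx i + time_idx j' = time_idx i' + time_idx j \<longrightarrow>
        A $ (i, a) $ (j, b) = A $ (i', a) $ (j', b))"

definition causal_part ::
  "real^('t::{finite,linorder} \<times> 'b::finite)^('t \<times> 'a::finite) \<Rightarrow> real^('t \<times> 'b)^('t \<times> 'a)" where
  "causal_part A = (\<chi> i j. if fst j \<le> fst i then A $ i $ j else 0)"

definition anticausal_part ::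
  "real^('t::{finite,linorder} \<times> 'b::finite)^('t \<times> 'a::finite) \<Rightarrow> real^('t \<times> 'b)^('t \<times> 'a)" where
  "anticausal_part A = (\<chi> i j. if fst i < fst j then A $ i $ j else 0)"

(* Entrywise (not just blockwise) lower triangular: the rows and columns of a stacked signal are
   ordered lexicographically. *)
definition lower_triangular ::
  "real^('t::{finite,linorder} \<times> 'm::{finite,linorder})^('t \<times> 'm) \<Rightarrow> bool" where
  "lower_triangular A \<longleftrightarrow>
     (\<forall>i j a b. i < j \<or> (i = j \<and> a < b) \<longrightarrow> A $ (i, a) $ (j, b) = 0)"

definition psd :: "real^'n^'n::finite \<Rightarrow> bool" where
  "psd A \<longleftrightarrow> transpose A = A \<and> (\<forall>x. 0 \<le> x \<bullet> (A *v x))"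

definition pd :: "real^'n^'n::finite \<Rightarrow> bool" where
  "pd A \<longleftrightarrow> transpose A = A \<and> (\<forall>x. x \<noteq> 0 \<longrightarrow> 0 < x \<bullet> (A *v x))"

definition hcat :: "real^'a^'r \<Rightarrow> real^'b^'r \<Rightarrow> real^('a + 'b)^'r" (infixr "|||" 63) where
  "A ||| B = (\<chi> i j. case j of Inl a \<Rightarrow> A $ i $ a | Inr b \<Rightarrow> B $ i $ b)"

definition vcat :: "real^'c^'a \<Rightarrow> real^'c^'b \<Rightarrow> real^'c^('a + 'b)" (infixr "'/'/'/" 62) where
  "A /// B = (\<chi> i. case i of Inl a \<Rightarrow> A $ a | Inr b \<Rightarrow> B $ b)"

(* Qh and Rh are square roots of the weights; x and u are the physical signals, so that
   Qh *v x and Rh *v u are the normalized ones. *)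
definition normalized_operators ::
  "real^'n^'n \<Rightarrow> real^'m^'n \<Rightarrow> real^'n^'p \<Rightarrow>
   real^('t::{finite,linorder} \<times> 'n::finite)^('t \<times> 'n) \<Rightarrow>
   real^('t \<times> 'm::finite)^('t \<times> 'm) \<Rightarrow>
   real^('t \<times> 'm)^('t \<times> 'n) \<Rightarrow> real^('t \<times> 'n)^('t \<times> 'n) \<Rightarrow>
   real^('t \<times> 'm)^('t \<times> 'p::finite) \<Rightarrow> real^('t \<times> 'n)^('t \<times> 'p) \<Rightarrow> bool" where
  "normalized_operators A B C Qh Rh F G J L \<longleftrightarrow>
     (\<forall>x u w y v. lti_trajectory A B C x u w y v \<longleftrightarrow>
        Qh *v x = F *v (Rh *v u) + G *v w \<and> y = J *v (Rh *v u) + L *v w + v)"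

definition closed_loop ::
  "real^'u^'x \<Rightarrow> real^'w^'x \<Rightarrow> real^'w^'y \<Rightarrow> real^'y^'u \<Rightarrow>
   real^('w::finite + 'y::finite)^('x::finite + 'u::finite)" where
  "closed_loop F G L E =
      (F ** E ** L + G ||| F ** E
       /// E ** L      ||| E)"

definition K_to_E :: "real^'u^'y \<Rightarrow> real^'y^'u \<Rightarrow> real^'y::finite^'u::finite" where
  "K_to_E J K = K ** matrix_inv (mat 1 - J ** K)"

definition E_to_K :: "real^'u^'y \<Rightarrow> real^'y^'u \<Rightarrow> real^'y::finite^'u::finite" where
  "E_to_K J E = matrix_inv (mat 1 + E ** J) ** E"

definition benchmark_E ::
  "real^'u^'x \<Rightarrow> real^'w^'x \<Rightarrow> real^'w^'y \<Rightarrow> real^'y::finite^'u::finite" where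
  "benchmark_E F G L =
     - (matrix_inv (mat 1 + transpose F ** F) ** transpose F ** G ** transpose L **
        matrix_inv (mat 1 + L ** transpose L))"

(* The argument z is the stacked vector of w and v. *)
definition regret ::
  "real^'u^'x \<Rightarrow> real^'w^'x \<Rightarrow> real^'u^'y \<Rightarrow> real^'w^'y \<Rightarrow> real^'y^'u \<Rightarrow>
   real^('w::finite + 'y::finite) \<Rightarrow> real" where
  "regret F G J L K z =
     (let TK = closed_loop F G L (K_to_E J K);
          TK0 = closed_loop F G L (benchmark_E F G L)
      in z \<bullet> ((transpose TK ** TK - transpose TK0 ** TK0) *v z))"

definition couplings ::
  "'a::euclidean_space measure \<Rightarrow> 'a measure \<Rightarrow> ('a \<times> 'a) measure set" where
  "couplings \<mu> \<nu> =
     {\<pi>. prob_space \<pi> \<and> sets \<pi> = sets (borel \<Otimes>\<^sub>M borel) \<and>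
          distr \<pi> borel fst = \<mu> \<and> distr \<pi> borel snd = \<nu>}"

definition wasserstein2_sq :: "'a::euclidean_space measure \<Rightarrow> 'a measure \<Rightarrow> ennreal" where
  "wasserstein2_sq \<mu> \<nu> =
     (INF \<pi>\<in>couplings \<mu> \<nu>. \<integral>\<^sup>+ z. ennreal ((norm (fst z - snd z))\<^sup>2) \<partial>\<pi>)"

definition wasserstein2 :: "'a::euclidean_space measure \<Rightarrow> 'a measure \<Rightarrow> ennreal" where
  "wasserstein2 \<mu> \<nu> =
     (if wasserstein2_sq \<mu> \<nu> = \<infinity> then \<infinity> else ennreal (sqrt (enn2real (wasserstein2_sq \<mu> \<nu>))))"

definition wasserstein_ball :: "'a::euclidean_space measure \<Rightarrow> real \<Rightarrow> 'a measure set" where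
  "wasserstein_ball \<mu>0 r =
     {\<mu>. prob_space \<mu> \<and> sets \<mu> = sets borel \<and> wasserstein2 \<mu>0 \<mu> \<le> ennreal r}"

(* The regret is a quadratic form and every member of the ball around a nominal law with finite
   second moments has finite second moments itself, so the Bochner integral below never takes its
   default value for non-integrable functions. *)
definition worst_case_regret ::
  "real^'u^'x \<Rightarrow> real^'w^'x \<Rightarrow> real^'u^'y \<Rightarrow> real^'w^'y \<Rightarrow>
   (real^('w::finite + 'y::finite)) measure \<Rightarrow> real \<Rightarrow> real^'y^'u \<Rightarrow> ereal" where
  "worst_case_regret F G J L \<mu>0 r K =
     (SUP \<mu>\<in>wasserstein_ball \<mu>0 r. ereal (\<integral>z. regret F G J L K z \<partial>\<mu>))"

definition sym_block :: "real^'a^'a \<Rightarrow> real^'b^'a \<Rightarrow> real^'b^'b \<Rightarrow> real^('a::finite + 'b::finite)^('a + 'b)"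
  where
  "sym_block X11 X12 X22 =
     (X11           ||| X12
      /// transpose X12 ||| X22)"

definition lmi_matrix ::
  "real^'u^'x \<Rightarrow> real^'y^'u \<Rightarrow> real \<Rightarrow> real^'x^'x \<Rightarrow> real^'y^'x \<Rightarrow> real^'y^'y \<Rightarrow>
   real^('x::finite + 'y::finite + 'x + 'y + 'u::finite)^('x + 'y + 'x + 'y + 'u)" where
  "lmi_matrix P \<Xi> \<gamma> X11 X12 X22 =
     (X11               ||| X12   ||| mat \<gamma>                            ||| 0          ||| 0
      /// transpose X12 ||| X22   ||| 0                                ||| mat \<gamma>      ||| 0
      /// mat \<gamma>         ||| 0     ||| mat \<gamma>                            ||| - (P ** \<Xi>) ||| 0
      /// 0             ||| mat \<gamma> ||| - (transpose \<Xi> ** transpose P)   ||| mat \<gamma>      ||| transpose \<Xi>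
      /// 0             ||| 0     ||| 0                                ||| \<Xi>          ||| mat 1)"

(* H_gamma; the argument M stands for M_gamma. *)
definition H_matrix ::
  "real^('t \<times> 'p)^('t \<times> 'm) \<Rightarrow> real^('t \<times> 'm)^('t \<times> 'm) \<Rightarrow>
   real^('t::{finite,linorder} \<times> 'p::finite)^('t \<times> 'm::finite)" where
  "H_matrix W M = matrix_inv M ** causal_part (M ** W) - W"

definition sdp_feasible ::
  "real^('t \<times> 'p)^('t \<times> 'm) \<Rightarrow> real^('t \<times> 'm)^('t \<times> 'n) \<Rightarrow>
   (real \<Rightarrow> real^('t \<times> 'm)^('t \<times> 'm)) \<Rightarrow>
   ((real^('t::{finite,linorder} \<times> 'p::finite)^('t \<times> 'm::finite)) \<times> real \<times>
    (real^('t \<times> 'n::finite)^('t \<times> 'n)) \<times> (real^('t \<times> 'p)^('t \<times> 'n)) \<times>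
    (real^('t \<times> 'p)^('t \<times> 'p))) set" where
  "sdp_feasible W P M =
     {(Y, \<gamma>, X11, X12, X22).
        causal Y \<and> \<gamma> > 0 \<and> psd (sym_block X11 X12 X22) \<and>
        psd (lmi_matrix P (matrix_inv (M \<gamma>) ** Y + H_matrix W (M \<gamma>)) \<gamma> X11 X12 X22) \<and>
        pd (mat 1                                 ||| transpose (Y - anticausal_part (M \<gamma> ** W))
            /// Y - anticausal_part (M \<gamma> ** W) ||| mat 1)}"

definition sdp_objective ::
  "real \<Rightarrow> ((real^('t \<times> 'p)^('t \<times> 'm)) \<times> real \<times> (real^('t \<times> 'n::finite)^('t \<times> 'n)) \<times>
    (real^('t \<times> 'p)^('t \<times> 'n)) \<times> (real^('t::finite \<times> 'p::finite)^('t \<times> 'p))) \<Rightarrow> real" where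
  "sdp_objective r =
     (\<lambda>(Y, \<gamma>, X11, X12, X22).
        \<gamma> * (r\<^sup>2 - real (CARD('t) * (CARD('n) + CARD('p)))) + trace (sym_block X11 X12 X22))"

end

theory Submission
  imports Defs
begin

text \<open>Both optimal values are reduced to one scalar function. Parametrize the controllers by
\<open>E = K (I - J K)\<^bsup>-1\<^esup>\<close>; as \<open>J\<close> is strictly causal this is a bijection of the causal
matrices (\<open>K_to_E_causal\<close>, \<open>E_to_K_causal\<close>). For fixed \<open>E\<close> the regret is a quadratic form with a
symmetric matrix \<open>C\<close>, called \<open>excess_cost\<close> below.

For a nominal law with second moment matrix \<open>I\<close>, the worst expectation of a quadratic form \<open>C\<close>
with nonnegative trace over the Wasserstein ball is the infimum over \<open>\<gamma> > 0\<close> with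
\<open>\<gamma> I - C \<succ> 0\<close> of the dual value
\<open>\<gamma> (r\<^sup>2 - d) + \<gamma>\<^sup>2 tr (\<gamma> I - C)\<^bsup>-1\<^esup>\<close> (\<open>strong_duality\<close>). The bound from above is a completed
square integrated against a coupling. It is attained by pushing the nominal law forward along
\<open>\<gamma> (\<gamma> I - C)\<^bsup>-1\<^esup>\<close>, where \<open>\<gamma>\<close> is chosen, by the intermediate value theorem, so that this map has
transport cost exactly \<open>r\<^sup>2\<close>.

Completing the square in the control input, and passing to an orthonormal basis adapted to the
row space of \<open>[L I]\<close> and its complement, turns \<open>C\<close> into the quadratic form
\<open>2 c \<bullet> P \<Xi> d + |\<Xi> d|\<^sup>2\<close> with \<open>\<Xi> = T\<^bsup>1/2\<^esup> E U\<^bsup>1/2\<^esup> - W\<close> (\<open>rotated_excess\<close>;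
the factors \<open>T\<^bsup>1/2\<^esup>\<close>, \<open>U\<^bsup>1/2\<^esup>\<close>, \<open>V\<^bsup>1/2\<^esup>\<close> are called \<open>Th\<close>, \<open>Uh\<close>, \<open>Vh\<close> in the formulas). Its diagonal blocks
are \<open>0\<close> and \<open>\<Xi>\<^sup>T \<Xi>\<close>, whence the trace is nonnegative. Two Schur complements
finish the argument. Eliminating \<open>c\<close> shows that \<open>\<gamma> I - C \<succ> 0\<close> says exactly that \<open>M\<^sub>\<gamma> \<Xi>\<close> is a
strict contraction (\<open>pd_contraction_iff\<close>), and \<open>M\<^sub>\<gamma> \<Xi> = Y - W\<^sub>-\<close> for the causal matrix
\<open>Y = M\<^sub>\<gamma> T\<^bsup>1/2\<^esup> E U\<^bsup>1/2\<^esup> - W\<^sub>+\<close>. The large matrix inequality says that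
\<open>X\<close> dominates \<open>\<gamma>\<^sup>2\<close> times the inverse of the rotated \<open>\<gamma> I - C\<close>
(\<open>psd_lmi_iff\<close>, \<open>schur_trace_bound\<close>, \<open>schur_tight\<close>), so that minimizing
\<open>tr X\<close> produces the dual value. Hence a feasible point of the program yields a causal controller
whose worst-case regret is at most its objective value, and conversely every dual value is an
objective value.\<close>

section \<open>Symmetric matrices and second moments\<close>

lemma mat_mult_vector: "(mat k :: real^'n^'n) *v x = k *\<^sub>R x"
  by (simp add: vec_eq_iff matrix_vector_mult_def mat_def if_distrib if_distribR cong: if_cong)

lemma inner_matrix_transpose: "x \<bullet> (A *v y) = (transpose A *v x) \<bullet> (y :: real^'n)" for A :: "real^'n^'m"
  by (simp add: dot_lmul_matrix)

lemma inner_symmetric_matrix: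
  fixes A :: "real^'n^'n"
  assumes "transpose A = A" shows "x \<bullet> (A *v y) = y \<bullet> (A *v x)"
  using assms inner_matrix_transpose[of x A y] by (simp add: inner_commute)

lemma norm_gram: "(norm (A *v x))\<^sup>2 = x \<bullet> ((transpose A ** A) *v x)" for A :: "real^'n^'m"
  by (simp only: matrix_vector_mul_assoc[symmetric] inner_matrix_transpose[of x] transpose_transpose power2_norm_eq_inner)

lemma congruence_form: "x \<bullet> ((transpose A ** B ** A) *v x) = (A *v x) \<bullet> (B *v (A *v x))"
  for A :: "real^'n^'n"
  by (simp only: matrix_vector_mul_assoc[symmetric] inner_matrix_transpose[of x] transpose_transpose)

lemma trace_gram: "trace (transpose A ** A) = (\<Sum>j\<in>UNIV. (norm (A *v axis j 1))\<^sup>2)" for A :: "real^'n^'m"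
  by (simp add: trace_def matrix_matrix_mult_def transpose_def power2_norm_eq_inner inner_vec_def
      matrix_vector_mult_basis column_def)

lemma norm_matrix_vector_le_gram:
  fixes A :: "real^'n^'m"
  shows "(norm (A *v x))\<^sup>2 \<le> trace (transpose A ** A) * (norm x)\<^sup>2"
proof -
  have "trace (transpose A ** A) = (\<Sum>j\<in>UNIV. \<Sum>i\<in>UNIV. (A $ i $ j)\<^sup>2)"
    by (simp add: trace_def matrix_matrix_mult_def transpose_def power2_eq_square)
  also have "\<dots> = (\<Sum>i\<in>UNIV. (norm (A $ i))\<^sup>2)"
    by (subst sum.swap) (simp add: power2_norm_eq_inner inner_vec_def, simp add: power2_eq_square)
  finally have tr: "trace (transpose A ** A) = (\<Sum>i\<in>UNIV. (norm (A $ i))\<^sup>2)" .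
  have "(norm (A *v x))\<^sup>2 = (\<Sum>i\<in>UNIV. (A $ i \<bullet> x)\<^sup>2)"
    by (simp add: power2_norm_eq_inner inner_vec_def[of "A *v x"] matrix_vector_mul_component, simp add: power2_eq_square)
  also have "\<dots> \<le> (\<Sum>i\<in>UNIV. (norm (A $ i))\<^sup>2 * (norm x)\<^sup>2)"
    by (rule sum_mono) (metis Cauchy_Schwarz_ineq power2_norm_eq_inner)
  finally show ?thesis by (simp add: tr sum_distrib_right)
qed

lemma second_moment_quadratic:
  fixes S :: "real^'d^'d"
  assumes "has_bochner_integral \<mu> (\<lambda>z. \<chi> i j. z $ i * z $ j) (mat 1 :: real^'d^'d)"
  shows "has_bochner_integral \<mu> (\<lambda>z. z \<bullet> (S *v z)) (trace S)"
proof -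
  have "bounded_linear (\<lambda>Z::real^'d^'d. \<Sum>i\<in>UNIV. \<Sum>j\<in>UNIV. S $ i $ j * Z $ i $ j)"
    by (intro bounded_linear_sum bounded_linear_const_mult bounded_linear_compose[OF bounded_linear_vec_nth] bounded_linear_vec_nth)
  from has_bochner_integral_bounded_linear[OF this assms]
  have "has_bochner_integral \<mu> (\<lambda>z. \<Sum>i\<in>UNIV. \<Sum>j\<in>UNIV. S $ i $ j * (z $ i * z $ j)) 
     (\<Sum>i\<in>UNIV. \<Sum>j\<in>UNIV. S $ i $ j * (mat 1 :: real^'d^'d) $ i $ j)"
    by simp
  also have "(\<lambda>z::real^'d. \<Sum>i\<in>UNIV. \<Sum>j\<in>UNIV. S $ i $ j * (z $ i * z $ j)) = (\<lambda>z. z \<bullet> (S *v z))"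
    by (auto simp: inner_vec_def matrix_vector_mult_def sum_distrib_left mult_ac)
  also have "(\<Sum>i\<in>UNIV. \<Sum>j\<in>UNIV. S $ i $ j * (mat 1 :: real^'d^'d) $ i $ j) = trace S"
    by (simp add: trace_def mat_def if_distrib if_distribR cong: if_cong)
  finally show ?thesis .
qed

lemma invertible_matrix_inv:
  fixes A :: "real^'n^'n"
  assumes "invertible A" shows "A ** matrix_inv A = mat 1" "matrix_inv A ** A = mat 1"
  using someI_ex[of "\<lambda>A'. A ** A' = mat 1 \<and> A' ** A = mat 1"] assms
  by (auto simp: matrix_inv_def invertible_def)

lemma pd_matrix_inv:
  fixes B :: "real^'n^'n"
  assumes "pd B" shows "B ** matrix_inv B = mat 1" "matrix_inv B ** B = mat 1"
proof -
  have "inj ((*v) B)"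
    using assms by (auto simp: matrix_vector_mult_diff_distrib linear_inj_iff_eq_0[OF matrix_vector_mul_linear] pd_def)
  then have "invertible B"
    by (simp add: invertible_left_inverse matrix_left_invertible_injective)
  then show "B ** matrix_inv B = mat 1" "matrix_inv B ** B = mat 1"
    by (simp_all add: invertible_matrix_inv)
qed

lemma right_inverse_cancel: "A ** A' = mat 1 \<Longrightarrow> A *v (A' *v x) = (x::real^'n)" for A :: "real^'m^'n"
  by (metis matrix_vector_mul_assoc matrix_vector_mul_lid)

lemma symmetric_inverse:
  fixes B :: "real^'n^'n"
  assumes "transpose B = B" "B ** S = mat 1" shows "transpose S = S"
  by (metis assms matrix_left_right_inverse matrix_mul_assoc matrix_mul_lid matrix_mul_rid matrix_transpose_mul transpose_mat)

text \<open>For fixed \<open>z\<close> the expression \<open>z' \<bullet> C z' - \<gamma> |z - z'|\<^sup>2\<close> is maximal at \<open>z' = \<gamma> S z\<close>. The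
identity serves twice: dropping the square gives weak duality, and putting \<open>z'\<close> at the
maximizer gives the value attained by the extremal law.\<close>
lemma complete_square:
  fixes C S :: "real^'d^'d"
  assumes C: "transpose C = C" and S: "(mat \<gamma> - C) ** S = mat 1"
  shows "z' \<bullet> (C *v z') + (z' - \<gamma> *\<^sub>R (S *v z)) \<bullet> ((mat \<gamma> - C) *v (z' - \<gamma> *\<^sub>R (S *v z))) =
     \<gamma> * (norm (z - z'))\<^sup>2 + z \<bullet> ((\<gamma>\<^sup>2 *\<^sub>R S - mat \<gamma>) *v z)"
proof -
  define B s where "B = mat \<gamma> - C" and "s = S *v z"
  have Bs: "B *v s = z" using right_inverse_cancel[OF S] by (simp add: B_def s_def)
  have Bsym: "transpose B = B" using C by (simp add: B_def transpose_def vec_eq_iff mat_def)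
  have Cx: "C *v x = \<gamma> *\<^sub>R x - B *v x" for x
    by (simp add: B_def matrix_vector_mult_diff_rdistrib mat_mult_vector)
  have 1: "s \<bullet> (B *v z') = z' \<bullet> z"
    using inner_symmetric_matrix[OF Bsym, of s z'] Bs by simp
  have 2: "(\<gamma>\<^sup>2 *\<^sub>R S - mat \<gamma>) *v z = \<gamma>\<^sup>2 *\<^sub>R s - \<gamma> *\<^sub>R z"
    by (simp add: s_def matrix_vector_mult_diff_rdistrib mat_mult_vector scaleR_matrix_vector_assoc)
  show ?thesis
    unfolding B_def[symmetric] s_def[symmetric] 2 Cx
    by (simp add: Bs 1 matrix_vector_mult_diff_distrib matrix_vector_mult_scaleR inner_diff inner_add power2_norm_eq_inner inner_commute)
       (simp add: algebra_simps power2_eq_square)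
qed

section \<open>Top eigenvectors and resolvents of symmetric matrices\<close>

text \<open>A zero of a nonnegative form is a minimum of it, so the gradient \<open>2 B e\<close> vanishes there.\<close>
lemma psd_zero_form:
  fixes B :: "real^'n^'n"
  assumes sym: "transpose B = B" and nn: "\<And>x. 0 \<le> x \<bullet> (B *v x)" and e: "e \<bullet> (B *v e) = 0"
  shows "B *v e = 0"
proof (rule ccontr)
  assume ne: "B *v e \<noteq> 0"
  define y where "y = B *v e"
  define k where "k = y \<bullet> (B *v y)"
  \<comment> \<open>A step from \<open>e\<close> against the gradient; adding 1 to the denominator covers \<open>k = 0\<close>.\<close>
  define t where "t = - (y \<bullet> y) / (k + 1)"
  have k: "k \<ge> 0" using nn by (simp add: k_def)
  have yy: "y \<bullet> y > 0" using ne by (simp add: y_def)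
  have "e \<bullet> (B *v y) = y \<bullet> y"
    using inner_symmetric_matrix[OF sym, of e y] by (simp add: y_def)
  then have "(e + t *\<^sub>R y) \<bullet> (B *v (e + t *\<^sub>R y)) = 2 * t * (y \<bullet> y) + t\<^sup>2 * k"
    using e by (simp add: matrix_vector_right_distrib matrix_vector_mult_scaleR inner_add k_def y_def[symmetric])
       (simp add: power2_eq_square algebra_simps)
  also have "\<dots> = (y \<bullet> y)\<^sup>2 / (k + 1) * (k / (k + 1) - 2)"
    by (simp add: t_def power2_eq_square right_diff_distrib)
  also have "\<dots> < 0"
    using k yy by (intro mult_pos_neg divide_pos_pos) (auto simp: field_simps)
  finally show False using nn[of "e + t *\<^sub>R y"] by simp
qed

lemma symmetric_mat_diff: "transpose C = C \<Longrightarrow> transpose (mat k - C) = mat k - (C :: real^'n^'n)"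
  by (simp add: transpose_def vec_eq_iff mat_def)

text \<open>A maximizer of \<open>x \<bullet> C x\<close> on the unit sphere is an eigenvector by \<open>psd_zero_form\<close>, applied to
\<open>\<kappa> I - C\<close>. This one eigenvector replaces a full diagonalization.\<close>
lemma top_eigenvector:
  fixes C :: "real^'n^'n"
  assumes sym: "transpose C = C"
  obtains \<kappa> e where "norm e = 1" "C *v e = \<kappa> *\<^sub>R e" "\<And>x. x \<bullet> (C *v x) \<le> \<kappa> * (norm x)\<^sup>2"
proof -
  let ?S = "sphere 0 1 :: (real^'n) set"
  have "continuous_on ?S (\<lambda>x. x \<bullet> (C *v x))"
    by (intro continuous_intros linear_continuous_on) 
  moreover have "?S \<noteq> {}" using norm_axis_1[of undefined] by (auto intro!: exI[of _ "axis undefined 1"])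
  ultimately obtain e where e: "norm e = 1" "\<And>x. norm x = 1 \<Longrightarrow> x \<bullet> (C *v x) \<le> e \<bullet> (C *v e)"
    using continuous_attains_sup[of ?S "\<lambda>x. x \<bullet> (C *v x)"] by auto
  define \<kappa> where "\<kappa> = e \<bullet> (C *v e)"
  have max: "x \<bullet> (C *v x) \<le> \<kappa> * (norm x)\<^sup>2" for x
  proof (cases "x = 0")
    case False
    have "(x /\<^sub>R norm x) \<bullet> (C *v (x /\<^sub>R norm x)) \<le> \<kappa>"
      unfolding \<kappa>_def using False by (intro e) simp
    also have "(x /\<^sub>R norm x) \<bullet> (C *v (x /\<^sub>R norm x)) = (x \<bullet> (C *v x)) / (norm x)\<^sup>2"
      by (simp add: matrix_vector_mult_scaleR power2_eq_square field_simps)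
    finally show ?thesis using False by (simp add: field_simps)
  qed simp
  have "(mat \<kappa> - C) *v e = 0"
  proof (rule psd_zero_form)
    show "0 \<le> x \<bullet> ((mat \<kappa> - C) *v x)" for x
      using max[of x] by (simp add: matrix_vector_mult_diff_rdistrib mat_mult_vector inner_diff power2_norm_eq_inner)
    show "e \<bullet> ((mat \<kappa> - C) *v e) = 0"
      using e(1) by (simp add: matrix_vector_mult_diff_rdistrib mat_mult_vector inner_diff \<kappa>_def dot_square_norm)
  qed (simp add: sym symmetric_mat_diff)
  then have "C *v e = \<kappa> *\<^sub>R e" by (simp add: matrix_vector_mult_diff_rdistrib mat_mult_vector)
  with e(1) max show ?thesis using that by blast
qed

lemma pd_above_top:
  fixes C :: "real^'n^'n"
  assumes "transpose C = C" "\<And>x. x \<bullet> (C *v x) \<le> \<kappa> * (norm x)\<^sup>2" "\<kappa> < \<gamma>"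
  shows "pd (mat \<gamma> - C)"
proof -
  have "0 < x \<bullet> ((mat \<gamma> - C) *v x)" if "x \<noteq> 0" for x
  proof -
    have "\<kappa> * (norm x)\<^sup>2 < \<gamma> * (norm x)\<^sup>2" using that assms(3) by simp
    with assms(2)[of x] show ?thesis
      by (simp add: matrix_vector_mult_diff_rdistrib mat_mult_vector inner_diff power2_norm_eq_inner)
  qed
  with assms(1) show ?thesis by (simp add: pd_def symmetric_mat_diff)
qed

lemma resolvent_bound:
  fixes C :: "real^'n^'n"
  assumes "\<And>x. x \<bullet> (C *v x) \<le> \<kappa> * (norm x)\<^sup>2" "\<kappa> < \<gamma>" and S: "(mat \<gamma> - C) ** S = mat 1"
  shows "norm (S *v x) \<le> norm x / (\<gamma> - \<kappa>)"
proof -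
  define s where "s = S *v x"
  have Bs: "(mat \<gamma> - C) *v s = x" using right_inverse_cancel[OF S] by (simp add: s_def)
  have "(\<gamma> - \<kappa>) * (norm s)\<^sup>2 \<le> s \<bullet> ((mat \<gamma> - C) *v s)"
    using assms(1)[of s] by (simp add: matrix_vector_mult_diff_rdistrib mat_mult_vector inner_diff power2_norm_eq_inner algebra_simps)
  also have "\<dots> \<le> norm s * norm x" unfolding Bs by (rule norm_cauchy_schwarz)
  finally have "(\<gamma> - \<kappa>) * norm s \<le> norm x"
    by (cases "s = 0") (auto simp: power2_eq_square mult_ac)
  then show ?thesis using assms(2) by (simp add: s_def field_simps)
qed

text \<open>The trace is the mean squared displacement of the map \<open>\<gamma> S\<close> with \<open>S = (\<gamma> I - C)\<^bsup>-1\<^esup>\<close>, because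
\<open>C S = \<gamma> S - I\<close>. It is continuous in \<open>\<gamma> > \<kappa>\<close>, blows up at \<open>\<kappa>\<close> along the eigenvector \<open>e\<close>, and
tends to 0 at infinity, so it takes the value \<open>r\<^sup>2\<close>. Stationarity of the dual value in
\<open>\<gamma>\<close> is the same equation.\<close>
lemma balanced_multiplier:
  fixes C :: "real^'n^'n"
  assumes sym: "transpose C = C" and e: "norm e = 1" "C *v e = \<kappa> *\<^sub>R e"
    and max: "\<And>x. x \<bullet> (C *v x) \<le> \<kappa> * (norm x)\<^sup>2" and pos: "\<kappa> > 0" "r > 0"
  obtains \<gamma> where "\<gamma> > \<kappa>"
    "trace (transpose (C ** matrix_inv (mat \<gamma> - C)) ** (C ** matrix_inv (mat \<gamma> - C))) = r\<^sup>2"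
proof -
  define S where "S \<gamma> = matrix_inv (mat \<gamma> - C)" for \<gamma>
  define g where "g \<gamma> = trace (transpose (C ** S \<gamma>) ** (C ** S \<gamma>))" for \<gamma>
  have BS: "(mat \<gamma> - C) ** S \<gamma> = mat 1" and SB: "S \<gamma> ** (mat \<gamma> - C) = mat 1" if "\<gamma> > \<kappa>" for \<gamma>
    using pd_matrix_inv[OF pd_above_top[OF sym max that]] by (auto simp: S_def)
  have bound: "norm (S \<gamma> *v x) \<le> norm x / (\<gamma> - \<kappa>)" if "\<gamma> > \<kappa>" for \<gamma> x
    using resolvent_bound[OF max that BS[OF that]] .
  have g_sum: "g \<gamma> = (\<Sum>j\<in>UNIV. (norm (C *v (S \<gamma> *v axis j 1)))\<^sup>2)" for \<gamma>
    by (simp add: g_def trace_gram matrix_vector_mul_assoc)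
  obtain K where K: "K > 0" "\<And>x. norm (C *v x) \<le> norm x * K"
    using bounded_linear.pos_bounded[OF matrix_vector_mul_bounded_linear[of C]] by auto
  \<comment> \<open>At \<open>a\<close> the displacement of \<open>e\<close> alone is \<open>r\<close>; at \<open>b\<close> the resolvent bound makes the
    total displacement at most \<open>r\<close>.\<close>
  define a where "a = \<kappa> + \<kappa> / r"
  define D where "D = real CARD('n)"
  define b where "b = a + sqrt D * K / r"
  have D: "D > 0" by (simp add: D_def)
  have a: "a > \<kappa>" using pos by (simp add: a_def)
  have ab: "a \<le> b" using pos K D by (simp add: b_def)
  have lip: "continuous_on {a..b} (\<lambda>\<gamma>. S \<gamma> *v x)" for x
  proof -
    define c where "c = norm x / (a - \<kappa>) / (a - \<kappa>)"
    have "dist (S \<gamma> *v x) (S \<gamma>' *v x) \<le> c * dist \<gamma> \<gamma>'" if "\<gamma> \<in> {a..b}" "\<gamma>' \<in> {a..b}" for \<gamma> \<gamma>'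
    proof -
      have g: "\<gamma> > \<kappa>" "\<gamma>' > \<kappa>" using that a by auto
      have "S \<gamma> *v x - S \<gamma>' *v x = S \<gamma> *v ((mat \<gamma>' - C) *v (S \<gamma>' *v x)) - S \<gamma> *v ((mat \<gamma> - C) *v (S \<gamma>' *v x))"
        using right_inverse_cancel[OF BS[OF g(2)]] right_inverse_cancel[OF SB[OF g(1)]] by simp
      also have "\<dots> = S \<gamma> *v ((\<gamma>' - \<gamma>) *\<^sub>R (S \<gamma>' *v x))"
        by (simp add: matrix_vector_mult_diff_distrib[symmetric] matrix_vector_mult_diff_rdistrib mat_mult_vector)
           (simp add: matrix_vector_mult_diff_distrib matrix_vector_mult_scaleR scaleR_diff_left)
      finally have "norm (S \<gamma> *v x - S \<gamma>' *v x) = \<bar>\<gamma> - \<gamma>'\<bar> * norm (S \<gamma> *v (S \<gamma>' *v x))"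
        by (simp add: matrix_vector_mult_scaleR abs_minus_commute)
      moreover have "norm (S \<gamma> *v (S \<gamma>' *v x)) \<le> c"
      proof -
        have "norm (S \<gamma> *v (S \<gamma>' *v x)) \<le> norm (S \<gamma>' *v x) / (\<gamma> - \<kappa>)" by (rule bound[OF g(1)])
        also have "\<dots> \<le> norm x / (\<gamma>' - \<kappa>) / (\<gamma> - \<kappa>)"
          using bound[OF g(2), of x] g by (intro divide_right_mono) auto
        also have "\<dots> \<le> c" unfolding c_def using that g a
          by (intro frac_le) (auto intro!: frac_le divide_nonneg_pos)
        finally show ?thesis .
      qed
      ultimately show ?thesis
        by (simp add: dist_norm) (metis mult.commute mult_left_mono abs_ge_zero)
    qed
    moreover have "c \<ge> 0" using a by (simp add: c_def)
    ultimately have "c-lipschitz_on {a..b} (\<lambda>\<gamma>. S \<gamma> *v x)"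
      by (auto simp: lipschitz_on_def)
    then show ?thesis by (rule lipschitz_on_continuous_on)
  qed
  have cont: "continuous_on {a..b} g"
    unfolding g_sum by (intro continuous_intros lip linear_continuous_on_compose[OF lip] matrix_vector_mul_linear)
  have ga: "r\<^sup>2 \<le> g a"
  proof -
    have "S a *v e = (1 / (a - \<kappa>)) *\<^sub>R e"
    proof -
      have "(mat a - C) *v e = (a - \<kappa>) *\<^sub>R e"
        using e by (simp add: matrix_vector_mult_diff_rdistrib mat_mult_vector scaleR_diff_left)
      then have "e = (a - \<kappa>) *\<^sub>R (S a *v e)"
        using right_inverse_cancel[OF SB[OF a], of e] by (simp add: matrix_vector_mult_scaleR)
      then have "(1 / (a - \<kappa>)) *\<^sub>R e = (1 / (a - \<kappa>)) *\<^sub>R ((a - \<kappa>) *\<^sub>R (S a *v e))" by metis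
      then show ?thesis using a by simp
    qed
    then have "(C ** S a) *v e = (\<kappa> / (a - \<kappa>)) *\<^sub>R e"
      using e by (simp add: matrix_vector_mul_assoc[symmetric] matrix_vector_mult_scaleR)
    then have "(norm ((C ** S a) *v e))\<^sup>2 = r\<^sup>2"
      using e pos by (simp add: a_def)
    with norm_matrix_vector_le_gram[of "C ** S a" e] e show ?thesis by (simp add: g_def)
  qed
  have gb: "g b \<le> r\<^sup>2"
  proof -
    have bl: "b > \<kappa>" using a ab by simp
    have "(norm (C *v (S b *v axis j 1)))\<^sup>2 \<le> (K / (b - \<kappa>))\<^sup>2" for j
    proof (rule power_mono)
      have "norm (C *v (S b *v axis j 1)) \<le> norm (S b *v axis j 1) * K" by (rule K)
      also have "\<dots> \<le> (norm (axis j 1 :: real^'n) / (b - \<kappa>)) * K"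
        using K by (intro mult_right_mono bound[OF bl]) auto
      finally show "norm (C *v (S b *v axis j 1)) \<le> K / (b - \<kappa>)" by (simp add: mult.commute)
    qed simp
    then have "g b \<le> (\<Sum>j\<in>(UNIV::'n set). (K / (b - \<kappa>))\<^sup>2)" unfolding g_sum by (rule sum_mono)
    also have "\<dots> = (sqrt D * K / (b - \<kappa>))\<^sup>2" using D by (simp add: D_def power_mult_distrib power_divide)
    also have "\<dots> \<le> r\<^sup>2"
    proof (rule power_mono)
      have "sqrt D * K = r * (b - a)" using pos by (simp add: b_def)
      also have "\<dots> \<le> r * (b - \<kappa>)" using a pos by (intro mult_left_mono) auto
      finally show "sqrt D * K / (b - \<kappa>) \<le> r" using bl by (simp add: field_simps)
      show "0 \<le> sqrt D * K / (b - \<kappa>)" using bl D K by simp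
    qed
    finally show ?thesis .
  qed
  obtain \<gamma> where "a \<le> \<gamma>" "\<gamma> \<le> b" "g \<gamma> = r\<^sup>2"
    using IVT2'[of g b "r\<^sup>2" a] ga gb ab cont by auto
  with a show ?thesis by (intro that[of \<gamma>]) (auto simp: g_def S_def)
qed

section \<open>Wasserstein duality for quadratic forms\<close>

definition dual_value :: "real^'d^'d \<Rightarrow> real \<Rightarrow> real \<Rightarrow> real" where
  "dual_value C r \<gamma> = \<gamma> * (r\<^sup>2 - real CARD('d)) + \<gamma>\<^sup>2 * trace (matrix_inv (mat \<gamma> - C))"

lemma wasserstein2_leD:
  assumes "wasserstein2 \<mu> \<nu> \<le> ennreal r" "r > 0"
  shows "wasserstein2_sq \<mu> \<nu> \<le> ennreal (r\<^sup>2)"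
proof -
  have fin: "wasserstein2_sq \<mu> \<nu> \<noteq> \<infinity>" using assms by (auto simp: wasserstein2_def top_unique)
  then have "sqrt (enn2real (wasserstein2_sq \<mu> \<nu>)) \<le> r" using assms by (simp add: wasserstein2_def ennreal_le_iff)
  then have "enn2real (wasserstein2_sq \<mu> \<nu>) \<le> r\<^sup>2"
    using sqrt_le_D by blast
  then have "ennreal (enn2real (wasserstein2_sq \<mu> \<nu>)) \<le> ennreal (r\<^sup>2)" by (rule ennreal_leI)
  with fin show ?thesis by (simp add: ennreal_enn2real_if)
qed

lemma wasserstein2_leI:
  assumes "wasserstein2_sq \<mu> \<nu> \<le> ennreal (r\<^sup>2)" "r > 0"
  shows "wasserstein2 \<mu> \<nu> \<le> ennreal r"
proof -
  have fin: "wasserstein2_sq \<mu> \<nu> \<noteq> \<infinity>" using assms by (auto simp: top_unique)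
  have "enn2real (wasserstein2_sq \<mu> \<nu>) \<le> r\<^sup>2"
    using enn2real_mono[OF assms(1)] by simp
  then have "sqrt (enn2real (wasserstein2_sq \<mu> \<nu>)) \<le> r"
    using assms(2) by (simp add: real_le_lsqrt)
  then show ?thesis using fin by (simp add: wasserstein2_def ennreal_leI)
qed

lemma quadratic_measurable [measurable]:
  fixes C :: "real^'d^'d" shows "(\<lambda>z. z \<bullet> (C *v z)) \<in> borel_measurable borel"
  by (intro borel_measurable_continuous_onI continuous_intros linear_continuous_on_compose matrix_vector_mul_linear)

text \<open>The infimum defining the Wasserstein distance need not be attained by a coupling, so the bound
is proved up to an arbitrary \<open>e > 0\<close>. Integrability of the form under \<open>\<mu>\<close> has to be derived from
finite transport cost, since otherwise the integral could be a default value.\<close>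
lemma weak_duality:
  fixes C :: "real^'d^'d"
  assumes C: "transpose C = C" and \<gamma>: "\<gamma> > 0" and pd: "pd (mat \<gamma> - C)"
    and r: "r > 0"
    and mom: "has_bochner_integral \<mu>0 (\<lambda>z. \<chi> i j. z $ i * z $ j) (mat 1 :: real^'d^'d)"
    and ball: "\<mu> \<in> wasserstein_ball \<mu>0 r"
  shows "(\<integral>z. z \<bullet> (C *v z) \<partial>\<mu>) \<le> dual_value C r \<gamma>"
proof (rule field_le_epsilon)
  fix e :: real assume e: "e > 0"
  define S where "S = matrix_inv (mat \<gamma> - C)"
  have S: "(mat \<gamma> - C) ** S = mat 1" using pd_matrix_inv[OF pd] by (simp add: S_def)
  define D where "D = \<gamma>\<^sup>2 *\<^sub>R S - mat \<gamma>"
  have le: "z' \<bullet> (C *v z') \<le> \<gamma> * (norm (z - z'))\<^sup>2 + z \<bullet> (D *v z)" for z z'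
  proof -
    have "0 \<le> y \<bullet> ((mat \<gamma> - C) *v y)" for y using pd by (cases "y = 0") (auto simp: pd_def less_imp_le)
    from this[of "z' - \<gamma> *\<^sub>R (S *v z)"] complete_square[OF C S, of z' z] show ?thesis by (simp add: D_def)
  qed
  from ball have "wasserstein2_sq \<mu>0 \<mu> \<le> ennreal (r\<^sup>2)"
    using r wasserstein2_leD by (auto simp: wasserstein_ball_def)
  also have "\<dots> < ennreal (r\<^sup>2 + e / \<gamma>)" using e \<gamma> by (simp add: ennreal_less_iff)
  finally obtain \<pi> where \<pi>: "\<pi> \<in> couplings \<mu>0 \<mu>"
    and cost: "(\<integral>\<^sup>+ z. ennreal ((norm (fst z - snd z))\<^sup>2) \<partial>\<pi>) < ennreal (r\<^sup>2 + e / \<gamma>)"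
    by (auto simp: wasserstein2_sq_def INF_less_iff)
  then have pi: "prob_space \<pi>" and sp[measurable_cong]: "sets \<pi> = sets (borel \<Otimes>\<^sub>M borel)"
    and m1: "distr \<pi> borel fst = \<mu>0" and m2: "distr \<pi> borel snd = \<mu>" by (auto simp: couplings_def)
  have int_cost: "integrable \<pi> (\<lambda>z. (norm (fst z - snd z))\<^sup>2)"
    using cost by (intro integrableI_nonneg) (auto intro: less_trans)
  have cost': "(\<integral>z. (norm (fst z - snd z))\<^sup>2 \<partial>\<pi>) \<le> r\<^sup>2 + e / \<gamma>"
  proof -
    have "ennreal (\<integral>z. (norm (fst z - snd z))\<^sup>2 \<partial>\<pi>) = (\<integral>\<^sup>+ z. ennreal ((norm (fst z - snd z))\<^sup>2) \<partial>\<pi>)"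
      by (rule nn_integral_eq_integral[symmetric, OF int_cost]) simp
    with cost have "ennreal (\<integral>z. (norm (fst z - snd z))\<^sup>2 \<partial>\<pi>) \<le> ennreal (r\<^sup>2 + e / \<gamma>)" by simp
    then show ?thesis by (rule ennreal_le_iff[THEN iffD1, rotated]) (use e \<gamma> in auto)
  qed
  have mom1: "has_bochner_integral \<pi> (\<lambda>z. fst z \<bullet> (X *v fst z)) (trace X)" for X :: "real^'d^'d"
  proof -
    have "has_bochner_integral (distr \<pi> borel fst) (\<lambda>z. z \<bullet> (X *v z)) (trace X)"
      unfolding m1 by (rule second_moment_quadratic[OF mom])
    then show ?thesis by (simp add: has_bochner_integral_iff integrable_distr_eq integral_distr)
  qed
  have int_n1: "integrable \<pi> (\<lambda>z. (norm (fst z))\<^sup>2)"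
    using mom1[of "mat 1"] by (simp add: has_bochner_integral_iff power2_norm_eq_inner)
  obtain K where K: "K > 0" "\<And>x. norm (C *v x) \<le> norm x * K"
    using bounded_linear.pos_bounded[OF matrix_vector_mul_bounded_linear[of C]] by auto
  have int_C: "integrable \<pi> (\<lambda>z. snd z \<bullet> (C *v snd z))"
  proof (rule Bochner_Integration.integrable_bound)
    show "integrable \<pi> (\<lambda>z. 2 * K * ((norm (fst z))\<^sup>2 + (norm (fst z - snd z))\<^sup>2))"
      using Bochner_Integration.integrable_add[OF int_n1 int_cost] by simp
    have "\<bar>snd z \<bullet> (C *v snd z)\<bar> \<le> 2 * K * ((norm (fst z))\<^sup>2 + (norm (fst z - snd z))\<^sup>2)" for z
    proof -
      have "\<bar>snd z \<bullet> (C *v snd z)\<bar> \<le> norm (snd z) * norm (C *v snd z)" by (rule Cauchy_Schwarz_ineq2)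
      also have "\<dots> \<le> norm (snd z) * (norm (snd z) * K)" by (intro mult_left_mono K) auto
      also have "\<dots> = K * (norm (snd z))\<^sup>2" by (simp add: power2_eq_square)
      also have "\<dots> \<le> K * (2 * ((norm (fst z))\<^sup>2 + (norm (fst z - snd z))\<^sup>2))"
      proof (intro mult_left_mono)
        have "norm (snd z) \<le> norm (fst z) + norm (fst z - snd z)" by (metis norm_minus_commute norm_triangle_sub)
        then have "(norm (snd z))\<^sup>2 \<le> (norm (fst z) + norm (fst z - snd z))\<^sup>2" by (intro power_mono) auto
        also have "\<dots> \<le> 2 * ((norm (fst z))\<^sup>2 + (norm (fst z - snd z))\<^sup>2)"
          using sum_squares_bound[of "norm (fst z)" "norm (fst z - snd z)"] by (simp add: power2_sum)
        finally show "(norm (snd z))\<^sup>2 \<le> \<dots>" .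
      qed (use K in simp)
      finally show ?thesis by (simp add: algebra_simps)
    qed
    then show "AE z in \<pi>. norm (snd z \<bullet> (C *v snd z)) \<le> norm (2 * K * ((norm (fst z))\<^sup>2 + (norm (fst z - snd z))\<^sup>2))"
      unfolding real_norm_def by (intro AE_I2 order_trans[OF _ abs_ge_self])
    have "snd \<in> \<pi> \<rightarrow>\<^sub>M borel" by measurable
    then show "(\<lambda>z. snd z \<bullet> (C *v snd z)) \<in> borel_measurable \<pi>"
      by (rule measurable_compose[OF _ quadratic_measurable])
  qed
  have "(\<integral>z. z \<bullet> (C *v z) \<partial>\<mu>) = (\<integral>z. snd z \<bullet> (C *v snd z) \<partial>\<pi>)"
    unfolding m2[symmetric] by (rule integral_distr) auto
  also have "\<dots> \<le> (\<integral>z. \<gamma> * (norm (fst z - snd z))\<^sup>2 + fst z \<bullet> (D *v fst z) \<partial>\<pi>)"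
    using mom1[of D] by (intro integral_mono int_C Bochner_Integration.integrable_add integrable_mult_right int_cost le)
       (auto simp: has_bochner_integral_iff)
  also have "\<dots> = \<gamma> * (\<integral>z. (norm (fst z - snd z))\<^sup>2 \<partial>\<pi>) + trace D"
    using mom1[of D] int_cost by (simp add: has_bochner_integral_iff)
  also have "\<dots> \<le> \<gamma> * (r\<^sup>2 + e / \<gamma>) + trace D" using cost' \<gamma> by simp
  also have "trace D = \<gamma>\<^sup>2 * trace S - \<gamma> * real CARD('d)"
    by (simp add: D_def trace_def mat_def sum_subtractf sum_distrib_left mult.commute)
  also have "\<gamma> * (r\<^sup>2 + e / \<gamma>) + (\<gamma>\<^sup>2 * trace S - \<gamma> * real CARD('d)) = dual_value C r \<gamma> + e"
    using \<gamma> by (simp add: dual_value_def S_def field_simps)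
  finally show "(\<integral>z. z \<bullet> (C *v z) \<partial>\<mu>) \<le> dual_value C r \<gamma> + e" .
qed

text \<open>The graph of \<open>A\<close> is a coupling; because the second moment matrix is \<open>I\<close>, its cost is the
squared Frobenius norm of \<open>A - I\<close>.\<close>
lemma pushforward_in_ball:
  fixes A :: "real^'d^'d"
  assumes r: "r > 0" and sets0: "sets \<mu>0 = sets borel" and prob: "prob_space \<mu>0"
    and mom: "has_bochner_integral \<mu>0 (\<lambda>z. \<chi> i j. z $ i * z $ j) (mat 1 :: real^'d^'d)"
    and cost: "trace (transpose (A - mat 1) ** (A - mat 1)) \<le> r\<^sup>2"
  shows "distr \<mu>0 borel ((*v) A) \<in> wasserstein_ball \<mu>0 r"
proof -
  note sets0[measurable_cong]
  have [measurable]: "(*v) A \<in> borel \<rightarrow>\<^sub>M borel" by (intro borel_measurable_continuous_onI linear_continuous_on) simp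
  define \<pi> where "\<pi> = distr \<mu>0 (borel \<Otimes>\<^sub>M borel) (\<lambda>z. (z, A *v z))"
  have \<pi>: "\<pi> \<in> couplings \<mu>0 (distr \<mu>0 borel ((*v) A))"
    unfolding couplings_def \<pi>_def
    by (auto intro!: prob_space.prob_space_distr[OF prob] simp: distr_distr comp_def distr_id2 sets0)
  have "(\<integral>\<^sup>+ z. ennreal ((norm (fst z - snd z))\<^sup>2) \<partial>\<pi>) = (\<integral>\<^sup>+ z. ennreal ((norm (z - A *v z))\<^sup>2) \<partial>\<mu>0)"
    unfolding \<pi>_def by (subst nn_integral_distr) auto
  also have "\<dots> = (\<integral>\<^sup>+ z. ennreal (z \<bullet> ((transpose (A - mat 1) ** (A - mat 1)) *v z)) \<partial>\<mu>0)"
  proof (intro nn_integral_cong arg_cong[where f = ennreal])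
    fix z
    show "(norm (z - A *v z))\<^sup>2 = z \<bullet> ((transpose (A - mat 1) ** (A - mat 1)) *v z)"
      by (simp add: norm_gram[symmetric] matrix_vector_mult_diff_rdistrib norm_minus_commute)
  qed
  also have "\<dots> = ennreal (trace (transpose (A - mat 1) ** (A - mat 1)))"
  proof -
    note hb = second_moment_quadratic[OF mom, of "transpose (A - mat 1) ** (A - mat 1)"]
    have "0 \<le> z \<bullet> ((transpose (A - mat 1) ** (A - mat 1)) *v z)" for z
      by (simp add: norm_gram[symmetric])
    with nn_integral_eq_integral[OF has_bochner_integral_iff[THEN iffD1, OF hb, THEN conjunct1]] hb
    show ?thesis by (simp add: has_bochner_integral_iff)
  qed
  also have "\<dots> \<le> ennreal (r\<^sup>2)" using cost by (rule ennreal_leI)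
  finally have "wasserstein2_sq \<mu>0 (distr \<mu>0 borel ((*v) A)) \<le> ennreal (r\<^sup>2)"
    unfolding wasserstein2_sq_def by (rule INF_lower2[OF \<pi>])
  then show ?thesis
    by (auto simp: wasserstein_ball_def intro!: wasserstein2_leI r prob_space.prob_space_distr[OF prob])
qed

text \<open>The sign of the top eigenvalue \<open>\<kappa>\<close> of \<open>C\<close> decides. If \<open>\<kappa> > 0\<close>, the balanced multiplier
gives a law in the ball that attains its dual value. If \<open>\<kappa> \<le> 0\<close>, every \<open>\<gamma> > 0\<close> is admissible and
the dual value tends to at most 0 as \<open>\<gamma>\<close> decreases to 0, while the nominal law itself already has
expectation \<open>tr C \<ge> 0\<close>.\<close>
lemma strong_duality:
  fixes C :: "real^'d^'d"
  assumes C: "transpose C = C" and tr: "trace C \<ge> 0"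
    and r: "r > 0" and prob: "prob_space \<mu>0" and sets0: "sets \<mu>0 = sets borel"
    and mom: "has_bochner_integral \<mu>0 (\<lambda>z. \<chi> i j. z $ i * z $ j) (mat 1 :: real^'d^'d)"
  shows "(SUP \<mu>\<in>wasserstein_ball \<mu>0 r. ereal (\<integral>z. z \<bullet> (C *v z) \<partial>\<mu>)) =
         (INF \<gamma>\<in>{\<gamma>. \<gamma> > 0 \<and> pd (mat \<gamma> - C)}. ereal (dual_value C r \<gamma>))" (is "?sup = ?inf")
proof (rule antisym)
  show "?sup \<le> ?inf"
    using weak_duality[OF C _ _ r mom] by (intro SUP_least INF_greatest) auto
  have push: "(\<integral>z. z \<bullet> (C *v z) \<partial>distr \<mu>0 borel ((*v) A)) = trace (transpose A ** C ** A)" for A :: "real^'d^'d"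
  proof -
    note sets0[measurable_cong]
    have [measurable]: "(*v) A \<in> borel \<rightarrow>\<^sub>M borel" by (intro borel_measurable_continuous_onI linear_continuous_on) simp
    have eq: "(A *v z) \<bullet> (C *v (A *v z)) = z \<bullet> ((transpose A ** C ** A) *v z)" for z
      by (rule congruence_form[symmetric])
    have "(\<integral>z. z \<bullet> (C *v z) \<partial>distr \<mu>0 borel ((*v) A)) = (\<integral>z. (A *v z) \<bullet> (C *v (A *v z)) \<partial>\<mu>0)"
      by (rule integral_distr) auto
    then show ?thesis
      using second_moment_quadratic[OF mom, of "transpose A ** C ** A"] by (simp add: eq has_bochner_integral_iff)
  qed
  obtain \<kappa> e where e: "norm e = 1" "C *v e = \<kappa> *\<^sub>R e" and max: "\<And>x. x \<bullet> (C *v x) \<le> \<kappa> * (norm x)\<^sup>2"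
    using top_eigenvector[OF C] by blast
  show "?inf \<le> ?sup"
  proof (cases "\<kappa> > 0")
    case True
    obtain \<gamma> where \<gamma>: "\<gamma> > \<kappa>"
      and bal: "trace (transpose (C ** matrix_inv (mat \<gamma> - C)) ** (C ** matrix_inv (mat \<gamma> - C))) = r\<^sup>2"
      using balanced_multiplier[OF C e max True r] by blast
    define S where "S = matrix_inv (mat \<gamma> - C)"
    have pd: "pd (mat \<gamma> - C)" by (rule pd_above_top[OF C max \<gamma>])
    have BS: "(mat \<gamma> - C) ** S = mat 1" using pd_matrix_inv[OF pd] by (simp add: S_def)
    have CS: "C ** S = \<gamma> *\<^sub>R S - mat 1"
    proof -
      have "C *v (S *v x) = \<gamma> *\<^sub>R (S *v x) - x" for x
        using right_inverse_cancel[OF BS, of x] by (simp add: matrix_vector_mult_diff_rdistrib mat_mult_vector algebra_simps)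
      then show ?thesis
        by (simp add: matrix_eq matrix_vector_mul_assoc[symmetric] matrix_vector_mult_diff_rdistrib scaleR_matrix_vector_assoc[symmetric])
    qed
    define \<mu> where "\<mu> = distr \<mu>0 borel ((*v) (\<gamma> *\<^sub>R S))"
    have in_ball: "\<mu> \<in> wasserstein_ball \<mu>0 r"
      unfolding \<mu>_def using bal by (intro pushforward_in_ball r sets0 prob mom) (simp add: S_def[symmetric] CS)
    have val: "(\<integral>z. z \<bullet> (C *v z) \<partial>\<mu>) = dual_value C r \<gamma>"
    proof -
      let ?A = "\<gamma> *\<^sub>R S"
      have "z \<bullet> ((transpose ?A ** C ** ?A) *v z) =
          z \<bullet> ((\<gamma> *\<^sub>R (transpose (C ** S) ** (C ** S)) + (\<gamma>\<^sup>2 *\<^sub>R S - mat \<gamma>)) *v z)" for z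
      proof -
        have "z \<bullet> ((transpose ?A ** C ** ?A) *v z) = (?A *v z) \<bullet> (C *v (?A *v z))"
          by (rule congruence_form)
        moreover have "(norm (z - ?A *v z))\<^sup>2 = z \<bullet> ((transpose (C ** S) ** (C ** S)) *v z)"
        proof -
          have "(C ** S) *v z = ?A *v z - z" by (simp add: CS matrix_vector_mult_diff_rdistrib)
          then show ?thesis
            by (simp only: norm_gram[symmetric] norm_minus_commute)
        qed
        ultimately show ?thesis
          using complete_square[OF C BS, of "?A *v z" z]
          by (simp add: scaleR_matrix_vector_assoc[symmetric] matrix_vector_mult_add_rdistrib inner_add)
      qed
      then have eq: "(\<lambda>z. z \<bullet> ((transpose ?A ** C ** ?A) *v z)) =
         (\<lambda>z. z \<bullet> ((\<gamma> *\<^sub>R (transpose (C ** S) ** (C ** S)) + (\<gamma>\<^sup>2 *\<^sub>R S - mat \<gamma>)) *v z))" by blast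
      have "trace (transpose ?A ** C ** ?A) = trace (\<gamma> *\<^sub>R (transpose (C ** S) ** (C ** S)) + (\<gamma>\<^sup>2 *\<^sub>R S - mat \<gamma>))"
        using second_moment_quadratic[OF mom, of "transpose ?A ** C ** ?A"]
          second_moment_quadratic[OF mom, of "\<gamma> *\<^sub>R (transpose (C ** S) ** (C ** S)) + (\<gamma>\<^sup>2 *\<^sub>R S - mat \<gamma>)"]
        unfolding eq by (rule has_bochner_integral_eq)
      also have "\<dots> = \<gamma> * trace (transpose (C ** S) ** (C ** S)) + \<gamma>\<^sup>2 * trace S - \<gamma> * real CARD('d)"
        by (simp add: trace_def mat_def sum.distrib sum_subtractf sum_distrib_left mult.commute)
      finally show ?thesis
        using bal by (simp add: \<mu>_def push dual_value_def S_def[symmetric] algebra_simps)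
    qed
    have "?inf \<le> ereal (dual_value C r \<gamma>)" using \<gamma> True pd by (intro INF_lower) auto
    also have "\<dots> \<le> ?sup" unfolding val[symmetric] by (rule SUP_upper[OF in_ball])
    finally show ?thesis .
  next
    case False
    \<comment> \<open>Here the resolvent has norm at most \<open>1 / \<gamma>\<close>, so the dual value is at most \<open>\<gamma> r\<^sup>2\<close>.\<close>
    have "?inf \<le> ereal x" if "x > 0" for x
    proof -
      define \<gamma> where "\<gamma> = x / r\<^sup>2"
      have \<gamma>: "\<gamma> > 0" using that r by (simp add: \<gamma>_def)
      have pd: "pd (mat \<gamma> - C)" using \<gamma> False by (intro pd_above_top[OF C max]) simp
      define S where "S = matrix_inv (mat \<gamma> - C)"
      have BS: "(mat \<gamma> - C) ** S = mat 1" using pd_matrix_inv[OF pd] by (simp add: S_def)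
      have "S $ i $ i \<le> 1 / \<gamma>" for i
      proof -
        have "axis i 1 \<bullet> (S *v axis i 1) \<le> norm (axis i 1 :: real^'d) * norm (S *v axis i 1)" by (rule norm_cauchy_schwarz)
        also have "norm (S *v axis i 1) \<le> norm (axis i 1 :: real^'d) / (\<gamma> - 0)"
        proof (rule resolvent_bound[OF _ \<gamma> BS])
          show "x \<bullet> (C *v x) \<le> 0 * (norm x)\<^sup>2" for x
            using max[of x] False by (smt (verit) mult_nonneg_nonneg mult_minus_left zero_le_power2)
        qed
        finally show ?thesis by (simp add: matrix_vector_mult_basis column_def inner_axis' )
      qed
      then have "trace S \<le> (\<Sum>i\<in>(UNIV::'d set). 1 / \<gamma>)" unfolding trace_def by (intro sum_mono)
      then have "\<gamma>\<^sup>2 * trace S \<le> \<gamma>\<^sup>2 * (real CARD('d) / \<gamma>)" by (intro mult_left_mono) auto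
      then have "\<gamma>\<^sup>2 * trace S \<le> \<gamma> * real CARD('d)" using \<gamma> by (simp add: power2_eq_square)
      moreover have "\<gamma> * r\<^sup>2 = x" using r by (simp add: \<gamma>_def)
      ultimately have "dual_value C r \<gamma> \<le> x"
        unfolding dual_value_def S_def[symmetric] right_diff_distrib by linarith
      moreover have "?inf \<le> ereal (dual_value C r \<gamma>)" using \<gamma> pd by (intro INF_lower) auto
      ultimately show ?thesis using order_trans ereal_less_eq(3) by blast
    qed
    then have "?inf \<le> 0"
      by - (rule ereal_le_epsilon2, auto)
    also have "0 \<le> ereal (\<integral>z. z \<bullet> (C *v z) \<partial>distr \<mu>0 borel ((*v) (mat 1)))"
      using tr by (simp add: push)
    also have "\<dots> \<le> ?sup"
      by (intro SUP_upper pushforward_in_ball r sets0 prob mom) (simp add: trace_def transpose_def matrix_matrix_mult_def)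
    finally show ?thesis .
  qed
qed

section \<open>Causal operators\<close>

lemma causal_add: "causal A \<Longrightarrow> causal B \<Longrightarrow> causal (A + B)"
  by (simp add: causal_def)

lemma causal_diff: "causal A \<Longrightarrow> causal B \<Longrightarrow> causal (A - B)"
  by (simp add: causal_def)

lemma causal_mat: "causal (mat k)"
  by (auto simp: causal_def mat_def)

lemma causal_mult: "causal A \<Longrightarrow> causal B \<Longrightarrow> causal (A ** B)"
  unfolding causal_def matrix_matrix_mult_def
  by (auto intro!: sum.neutral) (metis le_less_trans not_le)

lemma strictly_causal_mult_left: "strictly_causal A \<Longrightarrow> causal B \<Longrightarrow> strictly_causal (A ** B)"
  unfolding causal_def strictly_causal_def matrix_matrix_mult_def
  by (auto intro!: sum.neutral) (metis le_less_trans not_le)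

lemma strictly_causal_mult_right: "causal A \<Longrightarrow> strictly_causal B \<Longrightarrow> strictly_causal (A ** B)"
  unfolding causal_def strictly_causal_def matrix_matrix_mult_def
  by (auto intro!: sum.neutral) (metis less_le_trans not_le)

lemma strictly_causal_imp_causal: "strictly_causal A \<Longrightarrow> causal A"
  by (auto simp: causal_def strictly_causal_def)

lemma causal_part_causal: "causal (causal_part A)"
  by (auto simp: causal_def causal_part_def not_le)

lemma lower_triangular_imp_causal: "lower_triangular A \<Longrightarrow> causal A"
  by (simp add: causal_def lower_triangular_def)

lemma causal_plus_anticausal: "causal_part A + anticausal_part A = A"
  by (auto simp: causal_part_def anticausal_part_def vec_eq_iff)

text \<open>Causality of a matrix is invariance of this flag of subspaces.\<close>
definition silent_before :: "'t::{finite,linorder} \<Rightarrow> (real^('t \<times> 'a::finite)) set" where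
  "silent_before s = {x. \<forall>j a. j < s \<longrightarrow> x $ (j, a) = 0}"

lemma subspace_silent_before: "subspace (silent_before s)"
  by (auto simp: subspace_def silent_before_def)

lemma causal_preserves_silence:
  assumes "causal A" "x \<in> silent_before s" shows "A *v x \<in> silent_before s"
  unfolding silent_before_def matrix_vector_mult_def
proof (clarsimp, intro sum.neutral ballI)
  fix j a and k :: "'a \<times> 'b" assume "j < s"
  then show "A $ (j, a) $ k * x $ k = 0"
    using assms by (cases k) (auto simp: causal_def silent_before_def, metis less_trans not_less_iff_gr_or_eq)
qed

text \<open>An injective linear map that sends a finite-dimensional subspace into itself maps it onto
itself, so the inverse preserves the flag as well.\<close>
lemma causal_inverse:
  fixes A B :: "real^('t::{finite,linorder} \<times> 'a::finite)^('t \<times> 'a)"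
  assumes A: "causal A" and AB: "A ** B = mat 1" "B ** A = mat 1"
  shows "causal B"
  unfolding causal_def
proof (intro allI impI)
  fix i j :: 't and a b assume ij: "i < j"
  let ?V = "silent_before j :: (real^('t \<times> 'a)) set"
  have inj: "inj ((*v) A)" by (metis AB(2) matrix_left_invertible_injective)
  have "(*v) A ` ?V = ?V"
  proof (rule subspace_dim_equal)
    show "subspace ((*v) A ` ?V)" by (intro linear_subspace_image subspace_silent_before) simp
    show "(*v) A ` ?V \<subseteq> ?V" using causal_preserves_silence[OF A] by auto
    show "dim ?V \<le> dim ((*v) A ` ?V)"
      using dim_image_eq[of "(*v) A" ?V] inj by (simp add: inj_on_subset)
  qed (rule subspace_silent_before)
  moreover have "axis (j, b) 1 \<in> ?V" by (auto simp: silent_before_def axis_def)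
  ultimately obtain x where x: "x \<in> ?V" "axis (j, b) 1 = A *v x" by blast
  have "B *v axis (j, b) 1 = x" using right_inverse_cancel[OF AB(2)] x by simp
  then have "B $ (i, a) $ (j, b) = x $ (i, a)"
    by (simp add: matrix_vector_mult_basis column_def vec_eq_iff)
  with x ij show "B $ (i, a) $ (j, b) = 0" by (simp add: silent_before_def)
qed

lemma causal_matrix_inv:
  fixes A :: "real^('t::{finite,linorder} \<times> 'a::finite)^('t \<times> 'a)"
  shows "causal A \<Longrightarrow> invertible A \<Longrightarrow> causal (matrix_inv A)"
  by (metis causal_inverse invertible_matrix_inv)

lemma invertible_if_injective:
  fixes A :: "real^'n^'n"
  assumes "\<And>x. A *v x = 0 \<Longrightarrow> x = 0" shows "invertible A"
  using assms by (simp add: invertible_left_inverse matrix_left_invertible_ker)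

text \<open>A kernel vector satisfies \<open>x = - N x\<close>, whose block at time \<open>t\<close> depends only on earlier blocks of
\<open>x\<close>; it vanishes by induction on time.\<close>
lemma strictly_causal_invertible:
  fixes N :: "real^('t::{finite,linorder} \<times> 'a::finite)^('t \<times> 'a)"
  assumes N: "strictly_causal N" shows "invertible (mat 1 + N)"
proof (rule invertible_if_injective)
  fix x assume "(mat 1 + N) *v x = 0"
  then have x: "x = - (N *v x)" by (simp add: matrix_vector_mult_add_rdistrib eq_neg_iff_add_eq_0)
  have "\<forall>a. x $ (t, a) = 0" for t
  proof (induction "card {s. s < t}" arbitrary: t rule: less_induct)
    case less
    have IH: "x $ (s, a) = 0" if "s < t" for s a
    proof (rule less[rule_format])
      show "card {u. u < s} < card {u. u < t}" using that by (intro psubset_card_mono) auto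
    qed
    have "(N *v x) $ (t, a) = 0" for a
      unfolding matrix_vector_mult_def
    proof (clarsimp, intro sum.neutral ballI)
      fix k :: "'t \<times> 'a"
      show "N $ (t, a) $ k * x $ k = 0"
        using N IH by (cases k) (auto simp: strictly_causal_def, metis not_le)
    qed
    then show ?case by (subst x) simp
  qed
  then show "x = 0" by (simp add: vec_eq_iff)
qed

lemma strictly_causal_uminus: "strictly_causal N \<Longrightarrow> strictly_causal (- N)"
  by (simp add: strictly_causal_def)

lemma K_to_E_causal:
  assumes J: "strictly_causal J" and K: "causal K"
  shows "causal (K_to_E J K)"
proof -
  have N: "strictly_causal (J ** K)" by (rule strictly_causal_mult_left[OF J K])
  have "invertible (mat 1 - J ** K)"
    using strictly_causal_invertible[OF strictly_causal_uminus[OF N]] by simp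
  then show ?thesis unfolding K_to_E_def
    by (intro causal_mult K causal_matrix_inv causal_diff causal_mat strictly_causal_imp_causal N)
qed

text \<open>From \<open>(I + E J) K = E\<close> follows \<open>K = E (I - J K)\<close>, which is the inverse parametrization.\<close>
lemma E_to_K_causal:
  assumes J: "strictly_causal J" and E: "causal E"
  shows "causal (E_to_K J E)" and "K_to_E J (E_to_K J E) = E"
proof -
  have N: "strictly_causal (E ** J)" by (rule strictly_causal_mult_right[OF E J])
  have inv: "invertible (mat 1 + E ** J)" by (rule strictly_causal_invertible[OF N])
  then show K: "causal (E_to_K J E)" unfolding E_to_K_def
    by (intro causal_mult E causal_matrix_inv causal_add causal_mat strictly_causal_imp_causal N)
  define K where "K = E_to_K J E"
  have "(mat 1 + E ** J) ** K = E"
    using invertible_matrix_inv[OF inv] by (simp add: K_def E_to_K_def matrix_mul_assoc)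
  then have KE: "K = E ** (mat 1 - J ** K)"
    by (simp add: matrix_eq matrix_vector_mul_assoc[symmetric] matrix_vector_mult_add_rdistrib
        matrix_vector_mult_diff_rdistrib matrix_vector_mult_diff_distrib eq_diff_eq)
  have inv': "invertible (mat 1 - J ** K)"
    using strictly_causal_invertible[OF strictly_causal_uminus[OF strictly_causal_mult_left[OF J K]]] by (simp add: K_def)
  then have "K ** matrix_inv (mat 1 - J ** K) = E"
    by (subst KE) (simp add: matrix_mul_assoc[symmetric] invertible_matrix_inv(1)[OF inv'])
  then show "K_to_E J (E_to_K J E) = E" by (simp add: K_to_E_def K_def)
qed

section \<open>Block vectors and Schur complements\<close>

definition lpart :: "real^('a::finite + 'b::finite) \<Rightarrow> real^'a" where "lpart z = (\<chi> i. z $ Inl i)"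
definition rpart :: "real^('a::finite + 'b::finite) \<Rightarrow> real^'b" where "rpart z = (\<chi> i. z $ Inr i)"
definition vjoin :: "real^'a \<Rightarrow> real^'b \<Rightarrow> real^('a::finite + 'b::finite)" where
  "vjoin a b = (\<chi> i. case i of Inl j \<Rightarrow> a $ j | Inr j \<Rightarrow> b $ j)"

lemma part_vjoin [simp]: "lpart (vjoin a b) = a" "rpart (vjoin a b) = b"
  by (simp_all add: lpart_def rpart_def vjoin_def vec_eq_iff)

lemma vjoin_parts [simp]: "vjoin (lpart z) (rpart z) = z"
  by (simp add: lpart_def rpart_def vjoin_def vec_eq_iff split: sum.split)

lemma vjoin_eq_iff [simp]: "vjoin a b = vjoin c d \<longleftrightarrow> a = c \<and> b = d"
  by (metis part_vjoin)

lemma vjoin_zero: "vjoin 0 0 = 0"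
  by (simp add: vjoin_def vec_eq_iff split: sum.split)

lemma sum_UNIV_sum: "(\<Sum>i\<in>UNIV. f i) = (\<Sum>i\<in>UNIV. f (Inl i)) + (\<Sum>j\<in>UNIV. f (Inr j :: 'a::finite + 'b::finite))"
  by (subst UNIV_Plus_UNIV[symmetric], subst sum.Plus) auto

lemma inner_vjoin [simp]: "vjoin a b \<bullet> vjoin c d = a \<bullet> c + b \<bullet> d"
  by (simp add: inner_vec_def vjoin_def sum_UNIV_sum)

lemma norm_vjoin: "(norm (vjoin a b))\<^sup>2 = (norm a)\<^sup>2 + (norm b)\<^sup>2"
  by (simp add: power2_norm_eq_inner)

lemma hcat_vjoin [simp]: "(A ||| B) *v vjoin a b = A *v a + B *v b"
  by (simp add: vec_eq_iff hcat_def vjoin_def matrix_vector_mult_def sum_UNIV_sum)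

lemma vcat_mult [simp]: "(A /// B) *v z = vjoin (A *v z) (B *v z)"
  by (simp add: vec_eq_iff vcat_def vjoin_def matrix_vector_mult_def split: sum.split)

lemma trace_quadratic: "trace A = (\<Sum>i\<in>UNIV. axis i 1 \<bullet> (A *v axis i 1))" for A :: "real^'n^'n"
  by (simp add: trace_def matrix_vector_mult_basis column_def inner_axis')

lemma minus_matrix_vector: "(- A) *v x = - (A *v x)" "A *v (- x) = - (A *v x)" for A :: "real^'n^'m"
  by (simp_all add: matrix_vector_mult_def vec_eq_iff sum_negf)

lemma symmetric_from_form:
  fixes A :: "real^'n^'n"
  assumes "\<And>x y. x \<bullet> (A *v y) = y \<bullet> (A *v x)" shows "transpose A = A"
  by (metis (no_types) assms inner_commute inner_matrix_transpose matrix_eq vector_eq_ldot)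

text \<open>Stated as a bilinear form, so that it yields both the symmetry of the matrix and its quadratic
form.\<close>
lemma lmi_form:
  fixes P :: "real^'u^'x" and \<Xi> :: "real^'y^'u"
  shows "vjoin x1 (vjoin x2 (vjoin c (vjoin d e))) \<bullet>
      (lmi_matrix P \<Xi> \<gamma> X11 X12 X22 *v vjoin y1 (vjoin y2 (vjoin c' (vjoin d' e')))) =
    vjoin x1 x2 \<bullet> (sym_block X11 X12 X22 *v vjoin y1 y2) +
    \<gamma> * (x1 \<bullet> c' + x2 \<bullet> d' + c \<bullet> y1 + d \<bullet> y2 + c \<bullet> c' + d \<bullet> d') -
    c \<bullet> (P *v (\<Xi> *v d')) - c' \<bullet> (P *v (\<Xi> *v d)) + e \<bullet> (\<Xi> *v d') + e' \<bullet> (\<Xi> *v d) + e \<bullet> e'"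
proof -
  have "d \<bullet> (transpose \<Xi> *v w) = w \<bullet> (\<Xi> *v d)" for w
    using inner_matrix_transpose[of d "transpose \<Xi>" w] by (simp add: inner_commute)
  moreover have "(transpose P *v c') \<bullet> w = c' \<bullet> (P *v w)" for w
    using inner_matrix_transpose[of c' P w] by simp
  ultimately show ?thesis
    by (simp add: lmi_matrix_def sym_block_def mat_mult_vector inner_add minus_matrix_vector matrix_vector_mul_assoc[symmetric]
        del: transpose_matrix_vector)
       (simp add: algebra_simps)
qed

text \<open>The variable \<open>e\<close> of the last block enters the form only through \<open>|e + \<Xi> d|\<^sup>2 - |\<Xi> d|\<^sup>2\<close>. Minimizing
over \<open>e\<close> removes the square and supplies the term \<open>- |\<Xi> d|\<^sup>2\<close> of \<open>\<gamma> I - C\<close>.\<close>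
lemma psd_lmi_iff:
  fixes P :: "real^'u^'x" and \<Xi> :: "real^'y^'u" and X11 :: "real^'x^'x"
  assumes X: "transpose (sym_block X11 X12 X22) = sym_block X11 X12 X22"
    and C: "\<And>c d. vjoin c d \<bullet> (C *v vjoin c d) = 2 * (c \<bullet> (P *v (\<Xi> *v d))) + (norm (\<Xi> *v d))\<^sup>2"
  shows "psd (lmi_matrix P \<Xi> \<gamma> X11 X12 X22) \<longleftrightarrow>
    (\<forall>x q. 0 \<le> x \<bullet> (sym_block X11 X12 X22 *v x) + 2 * \<gamma> * (x \<bullet> q) + q \<bullet> ((mat \<gamma> - C) *v q))"
    (is "psd ?A \<longleftrightarrow> ?nonneg")
proof -
  let ?f = "\<lambda>x q. x \<bullet> (sym_block X11 X12 X22 *v x) + 2 * \<gamma> * (x \<bullet> q) + q \<bullet> ((mat \<gamma> - C) *v q)"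
  have split: "\<exists>x1 x2 c d e. t = vjoin x1 (vjoin x2 (vjoin c (vjoin d e)))" for t :: "real^('x + 'y + 'x + 'y + 'u)"
    by (metis vjoin_parts)
  have sym: "transpose ?A = ?A"
  proof (rule symmetric_from_form)
    fix s t :: "real^('x + 'y + 'x + 'y + 'u)"
    obtain x1 x2 c d e y1 y2 c' d' e' where
      "s = vjoin x1 (vjoin x2 (vjoin c (vjoin d e)))" "t = vjoin y1 (vjoin y2 (vjoin c' (vjoin d' e')))"
      using split by metis
    then show "s \<bullet> (?A *v t) = t \<bullet> (?A *v s)"
      using inner_symmetric_matrix[OF X, of "vjoin x1 x2" "vjoin y1 y2"]
      by (simp add: lmi_form inner_commute) 
  qed
  have form: "vjoin x1 (vjoin x2 (vjoin c (vjoin d e))) \<bullet> (?A *v vjoin x1 (vjoin x2 (vjoin c (vjoin d e)))) =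
    ?f (vjoin x1 x2) (vjoin c d) + (norm (e + \<Xi> *v d))\<^sup>2" for x1 x2 c d e
    unfolding lmi_form
    by (simp add: matrix_vector_mult_diff_rdistrib inner_diff C mat_mult_vector power2_norm_eq_inner inner_add inner_commute)
       (simp add: algebra_simps inner_commute)
  show ?thesis
  proof
    assume A: "psd ?A"
    show ?nonneg
    proof (intro allI)
      fix x q
      have "0 \<le> vjoin (lpart x) (vjoin (rpart x) (vjoin (lpart q) (vjoin (rpart q) (- (\<Xi> *v rpart q))))) \<bullet>
        (?A *v vjoin (lpart x) (vjoin (rpart x) (vjoin (lpart q) (vjoin (rpart q) (- (\<Xi> *v rpart q))))))"
        using A unfolding psd_def by blast
      then show "0 \<le> ?f x q" unfolding form by simp
    qed
  next
    assume R: ?nonneg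
    have "0 \<le> t \<bullet> (?A *v t)" for t
    proof -
      obtain x1 x2 c d e where t: "t = vjoin x1 (vjoin x2 (vjoin c (vjoin d e)))" using split by blast
      show ?thesis unfolding t form by (rule add_nonneg_nonneg[OF R[rule_format] zero_le_power2])
    qed
    with sym show "psd ?A" by (simp add: psd_def)
  qed
qed

lemma spectral_factor_norm:
  fixes M :: "real^'u^'u" and P :: "real^'u^'x"
  assumes M: "transpose M ** M = mat (1 / \<gamma>) + (1 / \<gamma>\<^sup>2) *\<^sub>R (transpose P ** P)"
  shows "(norm (M *v s))\<^sup>2 = (norm s)\<^sup>2 / \<gamma> + (norm (P *v s))\<^sup>2 / \<gamma>\<^sup>2"
  unfolding norm_gram[of M] M norm_gram[of P]
  by (simp add: matrix_vector_mult_add_rdistrib mat_mult_vector scaleR_matrix_vector_assoc[symmetric] inner_add power2_norm_eq_inner)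

text \<open>Minimizing the form of \<open>\<gamma> I - C\<close> over \<open>c\<close>, at \<open>c = P \<Xi> d / \<gamma>\<close>, leaves
\<open>\<gamma> |d|\<^sup>2 - |\<Xi> d|\<^sup>2 - |P \<Xi> d|\<^sup>2 / \<gamma>\<close>. By the choice of \<open>M\<close> this equals \<open>\<gamma> (|d|\<^sup>2 - |N d|\<^sup>2)\<close>, and the
block matrix with off-diagonal block \<open>N\<close> has the Schur complement \<open>|d|\<^sup>2 - |N d|\<^sup>2\<close>.\<close>
lemma pd_contraction_iff:
  fixes \<Xi> N :: "real^'y^'u" and P :: "real^'u^'x" and M :: "real^'u^'u"
  assumes \<gamma>: "\<gamma> > 0" and M: "transpose M ** M = mat (1 / \<gamma>) + (1 / \<gamma>\<^sup>2) *\<^sub>R (transpose P ** P)"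
    and N: "N = M ** \<Xi>" and sym: "transpose C = C"
    and C: "\<And>c d. vjoin c d \<bullet> (C *v vjoin c d) = 2 * (c \<bullet> (P *v (\<Xi> *v d))) + (norm (\<Xi> *v d))\<^sup>2"
  shows "pd (mat 1 ||| transpose N /// N ||| mat 1) \<longleftrightarrow> pd (mat \<gamma> - C)"
proof -
  let ?A = "mat 1 ||| transpose N /// N ||| mat 1"
  have Nd: "(norm (N *v d))\<^sup>2 = (norm (\<Xi> *v d))\<^sup>2 / \<gamma> + (norm (P *v (\<Xi> *v d)))\<^sup>2 / \<gamma>\<^sup>2" for d
    using spectral_factor_norm[OF M, of "\<Xi> *v d"] by (simp add: N matrix_vector_mul_assoc)
  have tr: "x \<bullet> (transpose N *v y) = y \<bullet> (N *v x)" for x y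
    using inner_matrix_transpose[of x "transpose N" y] by (simp add: inner_commute)
  have symA: "transpose ?A = ?A"
  proof (rule symmetric_from_form)
    fix x y :: "real^('y + 'u)"
    obtain a b c d where "x = vjoin a b" "y = vjoin c d" by (metis vjoin_parts)
    then show "x \<bullet> (?A *v y) = y \<bullet> (?A *v x)"
      by (simp add: inner_add tr inner_commute del: transpose_matrix_vector)
  qed
  have fA: "vjoin d e \<bullet> (?A *v vjoin d e) = ((norm d)\<^sup>2 - (norm (N *v d))\<^sup>2) + (norm (e + N *v d))\<^sup>2" for d e
    by (simp add: inner_add tr power2_norm_eq_inner inner_commute del: transpose_matrix_vector)
  have fB: "vjoin c d \<bullet> ((mat \<gamma> - C) *v vjoin c d) =
      \<gamma> * (norm (c - (1 / \<gamma>) *\<^sub>R (P *v (\<Xi> *v d))))\<^sup>2 + \<gamma> * ((norm d)\<^sup>2 - (norm (N *v d))\<^sup>2)" for c d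
  proof -
    define p where "p = P *v (\<Xi> *v d)"
    have 1: "\<gamma> * (norm (c - (1 / \<gamma>) *\<^sub>R p))\<^sup>2 = \<gamma> * (c \<bullet> c) - 2 * (c \<bullet> p) + (p \<bullet> p) / \<gamma>"
      using \<gamma> by (simp add: power2_norm_eq_inner inner_diff inner_commute) (simp add: field_simps)
    have 2: "\<gamma> * (norm (N *v d))\<^sup>2 = (norm (\<Xi> *v d))\<^sup>2 + (p \<bullet> p) / \<gamma>"
      unfolding Nd p_def[symmetric] power2_norm_eq_inner[of p] using \<gamma> by (simp add: field_simps power2_eq_square)
    have "vjoin c d \<bullet> ((mat \<gamma> - C) *v vjoin c d) = \<gamma> * (c \<bullet> c + d \<bullet> d) - (2 * (c \<bullet> p) + (norm (\<Xi> *v d))\<^sup>2)"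
      by (simp add: matrix_vector_mult_diff_rdistrib mat_mult_vector inner_diff C p_def)
    then show ?thesis
      unfolding p_def[symmetric] right_diff_distrib 1 2 by (simp add: power2_norm_eq_inner algebra_simps)
  qed
  let ?contr = "\<forall>d. d \<noteq> 0 \<longrightarrow> (norm (N *v d))\<^sup>2 < (norm d)\<^sup>2"
  have "pd ?A \<longleftrightarrow> ?contr"
  proof
    assume A: "pd ?A"
    show ?contr
    proof (intro allI impI)
      fix d :: "real^'y" assume "d \<noteq> 0"
      then have "vjoin d (- (N *v d)) \<noteq> 0" by (metis part_vjoin(1) vjoin_zero)
      with A have "0 < vjoin d (- (N *v d)) \<bullet> (?A *v vjoin d (- (N *v d)))" unfolding pd_def by blast
      then show "(norm (N *v d))\<^sup>2 < (norm d)\<^sup>2" unfolding fA by simp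
    qed
  next
    assume R: ?contr
    have "0 < x \<bullet> (?A *v x)" if "x \<noteq> 0" for x
    proof -
      obtain d e where x: "x = vjoin d e" by (metis vjoin_parts)
      show ?thesis
      proof (cases "d = 0")
        case True
        then have "e \<noteq> 0" using that x vjoin_zero by auto
        with True show ?thesis unfolding x fA by simp
      next
        case False
        with R show ?thesis unfolding x fA by (intro add_pos_nonneg) auto
      qed
    qed
    with symA show "pd ?A" by (simp add: pd_def)
  qed
  also have "\<dots> \<longleftrightarrow> pd (mat \<gamma> - C)"
  proof
    assume B: "pd (mat \<gamma> - C)"
    show ?contr
    proof (intro allI impI)
      fix d :: "real^'y" assume "d \<noteq> 0"
      define c where "c = (1 / \<gamma>) *\<^sub>R (P *v (\<Xi> *v d))"
      have "vjoin c d \<noteq> 0" using \<open>d \<noteq> 0\<close> by (metis part_vjoin(2) vjoin_zero)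
      with B have "0 < vjoin c d \<bullet> ((mat \<gamma> - C) *v vjoin c d)" unfolding pd_def by blast
      then show "(norm (N *v d))\<^sup>2 < (norm d)\<^sup>2" unfolding fB c_def using \<gamma> by (simp add: zero_less_mult_iff)
    qed
  next
    assume R: ?contr
    have "0 < x \<bullet> ((mat \<gamma> - C) *v x)" if "x \<noteq> 0" for x
    proof -
      obtain c d where x: "x = vjoin c d" by (metis vjoin_parts)
      show ?thesis
      proof (cases "d = 0")
        case True
        then have "c \<noteq> 0" using that x vjoin_zero by auto
        with True \<gamma> show ?thesis unfolding x fB by simp
      next
        case False
        with R \<gamma> show ?thesis unfolding x fB by (intro add_nonneg_pos) auto
      qed
    qed
    with sym show "pd (mat \<gamma> - C)" by (simp add: pd_def symmetric_mat_diff)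
  qed
  finally show ?thesis .
qed

text \<open>Evaluate at the minimizer \<open>q = - \<gamma> S x\<close>, with \<open>x\<close> running through the standard basis.\<close>
lemma schur_trace_bound:
  fixes X B :: "real^'d^'d"
  assumes S: "B ** S = mat 1"
    and nn: "\<And>x q. 0 \<le> x \<bullet> (X *v x) + 2 * \<gamma> * (x \<bullet> q) + q \<bullet> (B *v q)"
  shows "\<gamma>\<^sup>2 * trace S \<le> trace X"
proof -
  have "\<gamma>\<^sup>2 * (x \<bullet> (S *v x)) \<le> x \<bullet> (X *v x)" for x
    using nn[of x "- \<gamma> *\<^sub>R (S *v x)"] right_inverse_cancel[OF S, of x]
    by (simp add: matrix_vector_mult_scaleR minus_matrix_vector power2_eq_square inner_commute)
  then show ?thesis unfolding trace_quadratic sum_distrib_left by (intro sum_mono)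
qed

text \<open>With \<open>X = \<gamma>\<^sup>2 S\<close> the form is the single square \<open>(q + \<gamma> S x) \<bullet> B (q + \<gamma> S x)\<close>.\<close>
lemma schur_tight:
  fixes B :: "real^'d^'d"
  assumes S: "B ** S = mat 1" and nn: "\<And>y. 0 \<le> y \<bullet> (B *v y)" and symB: "transpose B = B"
  shows "0 \<le> x \<bullet> ((\<gamma>\<^sup>2 *\<^sub>R S) *v x) + 2 * \<gamma> * (x \<bullet> q) + q \<bullet> (B *v q)"
proof -
  let ?s = "S *v x"
  have Bs: "B *v ?s = x" by (rule right_inverse_cancel[OF S])
  have "?s \<bullet> (B *v q) = q \<bullet> x" using inner_symmetric_matrix[OF symB, of ?s q] Bs by simp
  then have "(q + \<gamma> *\<^sub>R ?s) \<bullet> (B *v (q + \<gamma> *\<^sub>R ?s)) = x \<bullet> ((\<gamma>\<^sup>2 *\<^sub>R S) *v x) + 2 * \<gamma> * (x \<bullet> q) + q \<bullet> (B *v q)"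
    by (simp add: matrix_vector_right_distrib matrix_vector_mult_scaleR Bs inner_add inner_commute scaleR_matrix_vector_assoc[symmetric])
       (simp add: algebra_simps power2_eq_square inner_commute)
  with nn[of "q + \<gamma> *\<^sub>R ?s"] show ?thesis by simp
qed

lemma sym_block_exists:
  fixes X :: "real^('a::finite + 'b::finite)^('a + 'b)"
  assumes "transpose X = X"
  obtains X11 X12 X22 where "X = sym_block X11 X12 X22"
proof
  have "X $ i $ j = X $ j $ i" for i j
    using arg_cong[OF assms, of "\<lambda>A. A $ j $ i"] by (simp add: transpose_def)
  then show "X = sym_block (\<chi> i j. X $ Inl i $ Inl j) (\<chi> i j. X $ Inl i $ Inr j) (\<chi> i j. X $ Inr i $ Inr j)"
    by (auto simp: sym_block_def hcat_def vcat_def transpose_def vec_eq_iff split: sum.split)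
qed

section \<open>The closed-loop cost in rotated coordinates\<close>

lemma matrix_inv_unique:
  fixes A :: "real^'n^'n"
  assumes "A ** B = mat 1" shows "matrix_inv A = B"
proof -
  have "invertible A" using assms by (auto simp: invertible_right_inverse)
  then show ?thesis by (metis assms invertible_matrix_inv(2) matrix_mul_assoc matrix_mul_lid matrix_mul_rid)
qed

lemma matrix_inv_transpose:
  fixes A :: "real^'n^'n"
  assumes "invertible A" shows "matrix_inv (transpose A) = transpose (matrix_inv A)"
  using invertible_matrix_inv(2)[OF assms]
  by (intro matrix_inv_unique) (simp add: matrix_transpose_mul[symmetric])

lemma gram_factor_norm:
  fixes A :: "real^'n^'m" and H :: "real^'n^'n"
  assumes "mat 1 + transpose A ** A = transpose H ** H"
  shows "(norm (H *v x))\<^sup>2 = (norm x)\<^sup>2 + (norm (A *v x))\<^sup>2"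
  unfolding norm_gram[of H] norm_gram[of A] assms[symmetric]
  by (simp add: matrix_vector_mult_add_rdistrib inner_add power2_norm_eq_inner)

lemma gram_factor_invertible:
  fixes A :: "real^'n^'m" and H :: "real^'n^'n"
  assumes "mat 1 + transpose A ** A = transpose H ** H"
  shows "invertible H"
proof (rule invertible_if_injective)
  fix x assume "H *v x = 0"
  then have "(norm x)\<^sup>2 + (norm (A *v x))\<^sup>2 = 0" using gram_factor_norm[OF assms, of x] by simp
  then show "x = 0" by (simp add: add_nonneg_eq_0_iff)
qed

lemma orthogonal_congruence_shift:
  fixes C \<Phi> :: "real^'d^'d"
  assumes "orthogonal_matrix \<Phi>"
  shows "mat \<gamma> - transpose \<Phi> ** C ** \<Phi> = transpose \<Phi> ** (mat \<gamma> - C) ** \<Phi>"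
proof -
  have "transpose \<Phi> *v (\<Phi> *v x) = x" for x
    using assms by (intro right_inverse_cancel) (simp add: orthogonal_matrix_def)
  then show ?thesis
    by (simp add: matrix_eq matrix_vector_mul_assoc[symmetric] matrix_vector_mult_diff_rdistrib
        matrix_vector_mult_diff_distrib mat_mult_vector matrix_vector_mult_scaleR del: transpose_matrix_vector)
qed

lemma pd_congruence:
  fixes B \<Phi> :: "real^'d^'d"
  assumes orth: "orthogonal_matrix \<Phi>"
  shows "pd (transpose \<Phi> ** B ** \<Phi>) \<longleftrightarrow> pd B"
proof -
  have *: "pd (transpose \<Psi> ** B ** \<Psi>)" if "orthogonal_matrix \<Psi>" "pd B" for \<Psi> B :: "real^'d^'d"
    unfolding pd_def
  proof (intro conjI allI impI)
    show "transpose (transpose \<Psi> ** B ** \<Psi>) = transpose \<Psi> ** B ** \<Psi>"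
      using that(2) by (simp add: matrix_transpose_mul pd_def matrix_mul_assoc)
    fix x :: "real^'d" assume "x \<noteq> 0"
    moreover have "transpose \<Psi> *v (\<Psi> *v x) = x"
      using that(1) by (intro right_inverse_cancel) (simp add: orthogonal_matrix_def)
    ultimately have "\<Psi> *v x \<noteq> 0" by auto
    then show "0 < x \<bullet> ((transpose \<Psi> ** B ** \<Psi>) *v x)"
      unfolding congruence_form using that(2) by (simp add: pd_def)
  qed
  have "B = transpose (transpose \<Phi>) ** (transpose \<Phi> ** B ** \<Phi>) ** transpose \<Phi>"
    using orth by (simp add: orthogonal_matrix_def matrix_mul_assoc) (simp add: matrix_mul_assoc[symmetric])
  with *[of "transpose \<Phi>" "transpose \<Phi> ** B ** \<Phi>"] *[of \<Phi> B] orth show ?thesis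
    by (metis orthogonal_matrix_transpose)
qed

lemma dual_value_congruence:
  fixes C \<Phi> :: "real^'d^'d"
  assumes orth: "orthogonal_matrix \<Phi>" and pd: "pd (mat \<gamma> - C)"
  shows "dual_value (transpose \<Phi> ** C ** \<Phi>) r \<gamma> = dual_value C r \<gamma>"
proof -
  define B S where "B = mat \<gamma> - C" and "S = matrix_inv B"
  have BS: "B ** S = mat 1" using pd_matrix_inv[OF pd] by (simp add: S_def B_def)
  have o: "\<Phi> ** transpose \<Phi> = mat 1" "transpose \<Phi> ** \<Phi> = mat 1" using orth by (auto simp: orthogonal_matrix_def)
  have "matrix_inv (transpose \<Phi> ** B ** \<Phi>) = transpose \<Phi> ** S ** \<Phi>"
  proof (rule matrix_inv_unique)
    have "(transpose \<Phi> ** B ** \<Phi>) ** (transpose \<Phi> ** S ** \<Phi>) = transpose \<Phi> ** B ** (\<Phi> ** transpose \<Phi>) ** S ** \<Phi>"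
      by (simp add: matrix_mul_assoc)
    also have "\<dots> = transpose \<Phi> ** (B ** S) ** \<Phi>" by (simp add: o matrix_mul_assoc)
    finally show "(transpose \<Phi> ** B ** \<Phi>) ** (transpose \<Phi> ** S ** \<Phi>) = mat 1" by (simp add: BS o)
  qed
  moreover have "trace (transpose \<Phi> ** S ** \<Phi>) = trace S"
    by (subst trace_mul_sym) (simp add: matrix_mul_assoc o)
  ultimately show ?thesis
    by (simp add: dual_value_def orthogonal_congruence_shift[OF orth] B_def S_def)
qed

text \<open>The matrix of the regret, in terms of the parameter \<open>E\<close> instead of \<open>K\<close>.\<close>
definition excess_cost ::
  "real^'u^'x \<Rightarrow> real^'w^'x \<Rightarrow> real^'w^'y \<Rightarrow> real^'y^'u \<Rightarrow> real^('w::finite + 'y::finite)^('w + 'y)" where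
  "excess_cost F G L E =
     transpose (closed_loop F G L E) ** closed_loop F G L E -
     transpose (closed_loop F G L (benchmark_E F G L)) ** closed_loop F G L (benchmark_E F G L)"

lemma regret_excess_cost: "regret F G J L K z = z \<bullet> (excess_cost F G L (K_to_E J K) *v z)"
  by (simp add: regret_def excess_cost_def Let_def)

lemma transpose_diff: "transpose (A - B) = transpose A - transpose (B :: real^'n^'m)"
  by (simp add: transpose_def vec_eq_iff)

lemma excess_cost_symmetric: "transpose (excess_cost F G L E) = excess_cost F G L E"
  by (simp add: excess_cost_def matrix_transpose_mul transpose_diff)

lemma excess_cost_form:
  "z \<bullet> (excess_cost F G L E *v z) =
     (norm (closed_loop F G L E *v z))\<^sup>2 - (norm (closed_loop F G L (benchmark_E F G L) *v z))\<^sup>2"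
  by (simp add: excess_cost_def matrix_vector_mult_diff_rdistrib inner_diff norm_gram)

locale factored_plant =
  fixes F :: "real^'u::finite^'x::finite" and G :: "real^'w::finite^'x" and L :: "real^'w^'y::finite"
    and Th :: "real^'u^'u" and Uh :: "real^'y^'y" and Vh :: "real^'w^'w"
    and W :: "real^'y^'u" and P :: "real^'u^'w"
  assumes T: "mat 1 + transpose F ** F = transpose Th ** Th"
    and U: "mat 1 + L ** transpose L = Uh ** transpose Uh"
    and V: "mat 1 + transpose L ** L = transpose Vh ** Vh"
    and W: "W = - (matrix_inv (transpose Th) ** transpose F ** G ** transpose L ** matrix_inv (transpose Uh))"
    and P: "P = matrix_inv (transpose Vh) ** transpose G ** F ** matrix_inv Th"
begin

lemma U': "mat 1 + transpose (transpose L) ** transpose L = transpose (transpose Uh) ** transpose Uh"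
  using U by simp

lemma inv_Th: "invertible Th" by (rule gram_factor_invertible[OF T])
lemma inv_Vh: "invertible Vh" by (rule gram_factor_invertible[OF V])
lemma inv_Uh: "invertible Uh"
  using gram_factor_invertible[OF U'] transpose_invertible by fastforce

text \<open>Since \<open>U\<^bsup>-1/2\<^esup> [L I]\<close> and \<open>V\<^bsup>-T/2\<^esup> [I -L\<^sup>T]\<close> have orthonormal rows and are orthogonal to each other,
stacking the second on the first gives an orthogonal matrix, of which this is the transpose.
In the new coordinates \<open>(c, d)\<close> the noise seen by the controller, \<open>L w + v\<close>, is
\<open>U\<^bsup>1/2\<^esup> d\<close>, so \<open>c\<close> is the part of the disturbance that is invisible to it.\<close>
definition rotation :: "real^('w + 'y)^('w + 'y)" where
  "rotation = (matrix_inv Vh           ||| transpose L ** transpose (matrix_inv Uh)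
               /// - (L ** matrix_inv Vh) ||| transpose (matrix_inv Uh))"

lemma rotation_vjoin:
  "rotation *v vjoin c d =
     vjoin (matrix_inv Vh *v c + transpose L *v (transpose (matrix_inv Uh) *v d))
           (transpose (matrix_inv Uh) *v d - L *v (matrix_inv Vh *v c))"
  by (simp add: rotation_def minus_matrix_vector matrix_vector_mul_assoc[symmetric] del: transpose_matrix_vector)

lemma transpose_Uh_inv: "transpose Uh *v (transpose (matrix_inv Uh) *v d) = d"
  by (rule right_inverse_cancel)
     (simp add: matrix_transpose_mul[symmetric] invertible_matrix_inv[OF inv_Uh])

lemma rotation_orthogonal: "orthogonal_matrix rotation"
proof -
  have "norm (rotation *v q) = norm q" for q
  proof -
    obtain c d where q: "q = vjoin c d" by (metis vjoin_parts)
    define a b where "a = matrix_inv Vh *v c" and "b = transpose (matrix_inv Uh) *v d"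
    have ab: "Vh *v a = c" "transpose Uh *v b = d"
      using right_inverse_cancel[OF invertible_matrix_inv(1)[OF inv_Vh]] transpose_Uh_inv by (auto simp: a_def b_def)
    have "(norm (rotation *v q))\<^sup>2 = (norm (a + transpose L *v b))\<^sup>2 + (norm (b - L *v a))\<^sup>2"
      by (simp only: q rotation_vjoin norm_vjoin a_def b_def)
    also have "\<dots> = ((norm a)\<^sup>2 + (norm (L *v a))\<^sup>2) + ((norm b)\<^sup>2 + (norm (transpose L *v b))\<^sup>2)"
    proof -
      have "a \<bullet> (transpose L *v b) = b \<bullet> (L *v a)"
        using inner_matrix_transpose[of a "transpose L" b] by (simp add: inner_commute)
      then show ?thesis
        by (simp add: power2_norm_eq_inner inner_add inner_diff inner_commute del: transpose_matrix_vector)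
    qed
    also have "\<dots> = (norm q)\<^sup>2"
      unfolding gram_factor_norm[OF V, symmetric] gram_factor_norm[OF U', symmetric] ab q norm_vjoin ..
    finally show ?thesis by simp
  qed
  then have "orthogonal_transformation ((*v) rotation)" by (simp add: orthogonal_transformation)
  then show ?thesis by (simp add: orthogonal_transformation_matrix)
qed

text \<open>The linear term \<open>F\<^sup>T G w\<close> of the cost in the input, written as a multiple of \<open>T\<^bsup>T/2\<^esup>\<close> so that the
square in \<open>T\<^bsup>1/2\<^esup> u\<close> can be completed. This is where the shapes of \<open>P\<close> and \<open>W\<close> come from.\<close>
lemma input_offset:
  "transpose F *v (G *v (matrix_inv Vh *v c + transpose L *v (transpose (matrix_inv Uh) *v d))) =
   transpose Th *v (transpose P *v c - W *v d)"
proof -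
  have inv_tr: "matrix_inv (transpose Th) = transpose (matrix_inv Th)" "matrix_inv (transpose Uh) = transpose (matrix_inv Uh)"
    "matrix_inv (transpose Vh) = transpose (matrix_inv Vh)"
    by (simp_all add: matrix_inv_transpose inv_Th inv_Uh inv_Vh)
  have c: "transpose Th *v (transpose (matrix_inv Th) *v x) = x" for x
    by (rule right_inverse_cancel)
       (simp add: matrix_transpose_mul[symmetric] invertible_matrix_inv[OF inv_Th])
  have "transpose Th *v (transpose P *v c) = transpose F *v (G *v (matrix_inv Vh *v c))"
    by (simp add: P inv_tr matrix_transpose_mul matrix_vector_mul_assoc[symmetric] c del: transpose_matrix_vector)
  moreover have "transpose Th *v (W *v d) = - (transpose F *v (G *v (transpose L *v (transpose (matrix_inv Uh) *v d))))"
    by (simp add: W inv_tr minus_matrix_vector matrix_vector_mul_assoc[symmetric] c del: transpose_matrix_vector)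
  ultimately show ?thesis
    by (simp add: matrix_vector_mult_diff_distrib matrix_vector_right_distrib del: transpose_matrix_vector)
qed

text \<open>The benchmark has \<open>T\<^bsup>1/2\<^esup> E\<^sub>0 U\<^bsup>1/2\<^esup> = W\<close>, hence gap \<open>\<Xi> = 0\<close>: it cancels the visible part of the offset
completely.\<close>
lemma benchmark_input: "Th *v (benchmark_E F G L *v (Uh *v d)) = W *v d"
proof -
  let ?T = "mat 1 + transpose F ** F" and ?U = "mat 1 + L ** transpose L"
  let ?b = "transpose (matrix_inv Uh) *v d"
  have invT: "invertible ?T" unfolding T by (intro invertible_mult transpose_invertible inv_Th)
  have invU: "invertible ?U" unfolding U by (intro invertible_mult transpose_invertible inv_Uh)
  have "?U *v ?b = Uh *v d"
    unfolding U by (simp only: matrix_vector_mul_assoc[symmetric] transpose_Uh_inv)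
  then have b: "matrix_inv ?U *v (Uh *v d) = ?b"
    using right_inverse_cancel[OF invertible_matrix_inv(2)[OF invU], of ?b] by simp
  have "transpose Th *v (Th *v (benchmark_E F G L *v (Uh *v d))) = ?T *v (benchmark_E F G L *v (Uh *v d))"
    unfolding T by (rule matrix_vector_mul_assoc)
  also have "\<dots> = - (transpose F *v (G *v (transpose L *v ?b)))"
    unfolding benchmark_E_def minus_matrix_vector matrix_vector_mul_assoc[symmetric, of _ "matrix_inv ?U"] b
    by (simp only: matrix_vector_mul_assoc[symmetric] right_inverse_cancel[OF invertible_matrix_inv(1)[OF invT]])
  also have "\<dots> = transpose Th *v (W *v d)"
    using input_offset[of 0 d] by (simp add: minus_matrix_vector del: transpose_matrix_vector)
  finally have *: "transpose Th *v (Th *v (benchmark_E F G L *v (Uh *v d))) = transpose Th *v (W *v d)" .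
  have "matrix_inv (transpose Th) ** transpose Th = mat 1"
    by (intro invertible_matrix_inv transpose_invertible inv_Th)
  from right_inverse_cancel[OF this] * show ?thesis by metis
qed

text \<open>After completing the square the cost is \<open>|\<Xi> d + P\<^sup>T c|\<^sup>2\<close> plus terms independent of the controller,
and \<open>\<Xi> = 0\<close> for the benchmark.\<close>
lemma rotated_excess:
  fixes E :: "real^'y^'u"
  defines "\<Xi> \<equiv> Th ** E ** Uh - W"
  shows "vjoin c d \<bullet> ((transpose rotation ** excess_cost F G L E ** rotation) *v vjoin c d) =
    2 * (c \<bullet> (P *v (\<Xi> *v d))) + (norm (\<Xi> *v d))\<^sup>2"
proof -
  define a b w g where "a = matrix_inv Vh *v c" and "b = transpose (matrix_inv Uh) *v d"
    and "w = a + transpose L *v b" and "g = transpose P *v c - W *v d"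
  have z: "rotation *v vjoin c d = vjoin w (b - L *v a)" by (simp only: rotation_vjoin a_def b_def w_def)
  have y: "L *v w + (b - L *v a) = Uh *v d"
  proof -
    have "L *v w + (b - L *v a) = (mat 1 + L ** transpose L) *v b"
      by (simp add: w_def matrix_vector_right_distrib matrix_vector_mult_add_rdistrib
          matrix_vector_mul_assoc[symmetric] del: transpose_matrix_vector)
    also have "\<dots> = Uh *v d"
      unfolding U b_def by (simp only: matrix_vector_mul_assoc[symmetric] transpose_Uh_inv)
    finally show ?thesis .
  qed
  \<comment> \<open>Stated for every \<open>E'\<close>, to be used for \<open>E\<close> and for the benchmark.\<close>
  have cost: "(norm (closed_loop F G L E' *v (rotation *v vjoin c d)))\<^sup>2 =
      (norm (Th *v (E' *v (Uh *v d)) + g))\<^sup>2 - (norm g)\<^sup>2 + (norm (G *v w))\<^sup>2" for E'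
  proof -
    define u where "u = E' *v (Uh *v d)"
    have u: "u = E' *v (L *v w) + E' *v (b - L *v a)"
      unfolding u_def y[symmetric] by (rule matrix_vector_right_distrib)
    have "closed_loop F G L E' *v (rotation *v vjoin c d) = vjoin (F *v u + G *v w) u"
      unfolding z closed_loop_def u
      by (simp add: matrix_vector_mult_add_rdistrib matrix_vector_mul_assoc[symmetric] matrix_vector_right_distrib)
    then have "(norm (closed_loop F G L E' *v (rotation *v vjoin c d)))\<^sup>2 =
        ((norm u)\<^sup>2 + (norm (F *v u))\<^sup>2) + 2 * ((F *v u) \<bullet> (G *v w)) + (norm (G *v w))\<^sup>2"
      by (simp add: norm_vjoin power2_norm_eq_inner inner_add inner_commute)
    also have "(F *v u) \<bullet> (G *v w) = u \<bullet> (transpose F *v (G *v w))"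
      using inner_matrix_transpose[of u "transpose F"] by simp
    also have "\<dots> = (Th *v u) \<bullet> g"
      unfolding w_def a_def b_def input_offset g_def
      using inner_matrix_transpose[of u "transpose Th"] by simp
    also have "(norm u)\<^sup>2 + (norm (F *v u))\<^sup>2 = (norm (Th *v u))\<^sup>2" using gram_factor_norm[OF T, of u] by simp
    finally show ?thesis
      unfolding u_def[symmetric] by (simp add: power2_norm_eq_inner inner_add inner_commute)
  qed
  define p where "p = transpose P *v c"
  have 1: "Th *v (E *v (Uh *v d)) + g = \<Xi> *v d + p"
    unfolding \<Xi>_def g_def p_def
    by (simp add: matrix_vector_mult_diff_rdistrib matrix_vector_mul_assoc[symmetric] del: transpose_matrix_vector)
  have 0: "Th *v (benchmark_E F G L *v (Uh *v d)) + g = p"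
    unfolding benchmark_input g_def p_def by simp
  have "vjoin c d \<bullet> ((transpose rotation ** excess_cost F G L E ** rotation) *v vjoin c d) =
      (norm (\<Xi> *v d + p))\<^sup>2 - (norm p)\<^sup>2"
    unfolding congruence_form excess_cost_form cost 1 0 by simp
  also have "\<dots> = 2 * (p \<bullet> (\<Xi> *v d)) + (norm (\<Xi> *v d))\<^sup>2"
    by (simp add: power2_norm_eq_inner inner_add inner_commute)
  also have "p \<bullet> (\<Xi> *v d) = c \<bullet> (P *v (\<Xi> *v d))"
    unfolding p_def by (rule inner_matrix_transpose[symmetric])
  finally show ?thesis .
qed

text \<open>The benchmark is optimal in Frobenius norm among all linear controllers, although in general
not in the order of quadratic forms: the cross term \<open>2 c \<bullet> P \<Xi> d\<close> changes sign with \<open>c\<close>, but it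
does not contribute to the trace.\<close>
lemma trace_excess_nonneg: "trace (excess_cost F G L E) \<ge> 0"
proof -
  let ?C = "excess_cost F G L E"
  have "trace ?C = trace (transpose rotation ** ?C ** rotation)"
    using rotation_orthogonal
    by (subst trace_mul_sym) (simp add: matrix_mul_assoc orthogonal_matrix_def)
  also have "\<dots> \<ge> 0"
    unfolding trace_quadratic
  proof (rule sum_nonneg)
    fix i :: "'w + 'y"
    obtain c d where i: "axis i 1 = vjoin c d" and cd: "c = 0 \<or> d = (0::real^'y)"
    proof (cases i)
      case (Inl j)
      have "axis i 1 = vjoin (axis j 1) 0" by (auto simp: Inl vjoin_def axis_def vec_eq_iff split: sum.split)
      with that show ?thesis by blast
    next
      case (Inr j)
      have "axis i 1 = vjoin 0 (axis j 1)" by (auto simp: Inr vjoin_def axis_def vec_eq_iff split: sum.split)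
      with that show ?thesis by blast
    qed
    show "0 \<le> axis i 1 \<bullet> ((transpose rotation ** ?C ** rotation) *v axis i 1)"
      unfolding i rotated_excess using cd by auto
  qed
  finally show ?thesis .
qed

end

section \<open>The semidefinite program\<close>

locale regret_synthesis = factored_plant F G L Th Uh Vh W P
  for F :: "real^('t::{finite,linorder} \<times> 'm::{finite,linorder})^('t \<times> 'n::finite)"
    and G :: "real^('t \<times> 'n)^('t \<times> 'n)"
    and L :: "real^('t \<times> 'n)^('t \<times> 'p::finite)"
    and Th Uh Vh W and P :: "real^('t \<times> 'm)^('t \<times> 'n)" +
  fixes M :: "real \<Rightarrow> real^('t \<times> 'm)^('t \<times> 'm)"
  assumes causal_Th: "causal Th" and causal_Uh: "causal Uh"
    and causal_M: "\<And>\<gamma>. \<gamma> > 0 \<Longrightarrow> causal (M \<gamma>)"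
    and M_factor: "\<And>\<gamma>. \<gamma> > 0 \<Longrightarrow>
      transpose (M \<gamma>) ** M \<gamma> = mat (1 / \<gamma>) + (1 / \<gamma>\<^sup>2) *\<^sub>R (transpose P ** P)"
begin

lemma inv_M: assumes "\<gamma> > 0" shows "invertible (M \<gamma>)"
proof (rule invertible_if_injective)
  fix x assume "M \<gamma> *v x = 0"
  then have "(norm x)\<^sup>2 / \<gamma> + (norm (P *v x))\<^sup>2 / \<gamma>\<^sup>2 = 0"
    using spectral_factor_norm[OF M_factor[OF assms], of x] by simp
  with assms show "x = 0" by (simp add: add_nonneg_eq_0_iff)
qed

context
  fixes E Y \<gamma>
  assumes \<gamma>: "\<gamma> > 0" and Y: "Y + causal_part (M \<gamma> ** W) = M \<gamma> ** (Th ** E ** Uh)"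
begin

text \<open>The matrices \<open>Y\<close> and \<open>E\<close> determine each other through \<open>Y + W\<^sub>+ = M\<^sub>\<gamma> T\<^bsup>1/2\<^esup> E U\<^bsup>1/2\<^esup>\<close>. Under this
correspondence the program's \<open>\<Xi>\<close> is the gap between \<open>E\<close> and the benchmark, and
\<open>Y - W\<^sub>-\<close> is \<open>M\<^sub>\<gamma>\<close> times it.\<close>
lemma gap_via_Y: "matrix_inv (M \<gamma>) ** Y + H_matrix W (M \<gamma>) = Th ** E ** Uh - W"
proof -
  have "matrix_inv (M \<gamma>) ** Y + matrix_inv (M \<gamma>) ** causal_part (M \<gamma> ** W) =
      matrix_inv (M \<gamma>) ** M \<gamma> ** (Th ** E ** Uh)"
    unfolding matrix_add_ldistrib[symmetric] Y by (simp only: matrix_mul_assoc)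
  then show ?thesis
    by (simp add: H_matrix_def invertible_matrix_inv[OF inv_M[OF \<gamma>]] algebra_simps)
qed

lemma scaled_gap: "Y - anticausal_part (M \<gamma> ** W) = M \<gamma> ** (Th ** E ** Uh - W)"
proof -
  have "M \<gamma> ** (Th ** E ** Uh - W) = M \<gamma> ** (Th ** E ** Uh) - M \<gamma> ** W"
    by (simp add: matrix_eq matrix_vector_mul_assoc[symmetric] matrix_vector_mult_diff_rdistrib matrix_vector_mult_diff_distrib)
  also have "\<dots> = Y + causal_part (M \<gamma> ** W) - (causal_part (M \<gamma> ** W) + anticausal_part (M \<gamma> ** W))"
    by (simp only: Y causal_plus_anticausal)
  finally show ?thesis by simp
qed

lemma pd_constraint_iff:
  "pd (mat 1 ||| transpose (Y - anticausal_part (M \<gamma> ** W)) /// Y - anticausal_part (M \<gamma> ** W) ||| mat 1)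
    \<longleftrightarrow> pd (mat \<gamma> - excess_cost F G L E)"
  by (subst pd_contraction_iff[OF \<gamma> M_factor[OF \<gamma>] scaled_gap _ rotated_excess])
     (simp_all add: matrix_transpose_mul excess_cost_symmetric matrix_mul_assoc
       orthogonal_congruence_shift[OF rotation_orthogonal] pd_congruence[OF rotation_orthogonal])

lemma lmi_constraint_iff:
  assumes "transpose (sym_block X11 X12 X22) = sym_block X11 X12 X22"
  shows "psd (lmi_matrix P (matrix_inv (M \<gamma>) ** Y + H_matrix W (M \<gamma>)) \<gamma> X11 X12 X22) \<longleftrightarrow>
    (\<forall>x q. 0 \<le> x \<bullet> (sym_block X11 X12 X22 *v x) + 2 * \<gamma> * (x \<bullet> q) +
      q \<bullet> ((mat \<gamma> - transpose rotation ** excess_cost F G L E ** rotation) *v q))"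
  unfolding gap_via_Y by (rule psd_lmi_iff[OF assms rotated_excess])

end

abbreviation "rotated_cost E \<equiv> transpose rotation ** excess_cost F G L E ** rotation"

lemma pd_rotated: "pd (mat \<gamma> - rotated_cost E) \<longleftrightarrow> pd (mat \<gamma> - excess_cost F G L E)"
  by (simp add: orthogonal_congruence_shift[OF rotation_orthogonal] pd_congruence[OF rotation_orthogonal])

lemma objective_eq:
  "sdp_objective r (Y, \<gamma>, X11, X12, X22) =
     \<gamma> * (r\<^sup>2 - real CARD(('t \<times> 'n) + ('t \<times> 'p))) + trace (sym_block X11 X12 X22)"
  for Y :: "real^('t \<times> 'p)^('t \<times> 'm)" and X11 :: "real^('t \<times> 'n)^('t \<times> 'n)"
  by (simp add: sdp_objective_def algebra_simps)

lemma feasible_point_bounds_dual: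
  fixes Y :: "real^('t \<times> 'p)^('t \<times> 'm)" and X11 :: "real^('t \<times> 'n)^('t \<times> 'n)"
  assumes feas: "(Y, \<gamma>, X11, X12, X22) \<in> sdp_feasible W P M"
  defines "E \<equiv> matrix_inv Th ** matrix_inv (M \<gamma>) ** (Y + causal_part (M \<gamma> ** W)) ** matrix_inv Uh"
  shows "causal E" and "\<gamma> > 0" and "pd (mat \<gamma> - excess_cost F G L E)"
    and "dual_value (excess_cost F G L E) r \<gamma> \<le> sdp_objective r (Y, \<gamma>, X11, X12, X22)"
proof -
  show \<gamma>: "\<gamma> > 0" using feas by (simp add: sdp_feasible_def)
  show "causal E" unfolding E_def using feas
    by (auto simp: sdp_feasible_def
        intro!: causal_mult causal_add causal_matrix_inv causal_Th causal_Uh causal_M inv_Th inv_Uh inv_M causal_part_causal)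
  have "M \<gamma> ** (Th ** E ** Uh) = M \<gamma> ** (Th ** matrix_inv Th) ** matrix_inv (M \<gamma>) **
      (Y + causal_part (M \<gamma> ** W)) ** (matrix_inv Uh ** Uh)"
    unfolding E_def by (simp only: matrix_mul_assoc)
  also have "\<dots> = Y + causal_part (M \<gamma> ** W)"
    by (simp add: invertible_matrix_inv inv_Th inv_Uh inv_M[OF \<gamma>])
  finally have Y: "Y + causal_part (M \<gamma> ** W) = M \<gamma> ** (Th ** E ** Uh)" by simp
  show pd: "pd (mat \<gamma> - excess_cost F G L E)"
    using feas pd_constraint_iff[OF \<gamma> Y] by (simp add: sdp_feasible_def)
  let ?B = "mat \<gamma> - rotated_cost E"
  have pdB: "pd ?B" using pd by (simp add: pd_rotated)
  have sym: "transpose (sym_block X11 X12 X22) = sym_block X11 X12 X22"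
    using feas by (simp add: sdp_feasible_def psd_def)
  have "\<gamma>\<^sup>2 * trace (matrix_inv ?B) \<le> trace (sym_block X11 X12 X22)"
  proof (rule schur_trace_bound)
    show "?B ** matrix_inv ?B = mat 1" by (rule pd_matrix_inv(1)[OF pdB])
    show "0 \<le> x \<bullet> (sym_block X11 X12 X22 *v x) + 2 * \<gamma> * (x \<bullet> q) + q \<bullet> (?B *v q)" for x q
      using feas lmi_constraint_iff[OF \<gamma> Y sym] by (simp add: sdp_feasible_def)
  qed
  then show "dual_value (excess_cost F G L E) r \<gamma> \<le> sdp_objective r (Y, \<gamma>, X11, X12, X22)"
    unfolding objective_eq dual_value_congruence[OF rotation_orthogonal pd, symmetric] by (simp add: dual_value_def)
qed

text \<open>The tight choice of \<open>X\<close> is \<open>\<gamma>\<^sup>2\<close> times the inverse of the rotated \<open>\<gamma> I - C\<close>.\<close>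
lemma dual_value_attained:
  fixes E :: "real^('t \<times> 'p)^('t \<times> 'm)"
  assumes E: "causal E" and \<gamma>: "\<gamma> > 0" and pd: "pd (mat \<gamma> - excess_cost F G L E)"
  obtains s where "s \<in> sdp_feasible W P M" "sdp_objective r s = dual_value (excess_cost F G L E) r \<gamma>"
proof -
  define Y where "Y = M \<gamma> ** (Th ** E ** Uh) - causal_part (M \<gamma> ** W)"
  have Y: "Y + causal_part (M \<gamma> ** W) = M \<gamma> ** (Th ** E ** Uh)" by (simp add: Y_def)
  let ?B = "mat \<gamma> - rotated_cost E"
  define S where "S = matrix_inv ?B"
  have pdB: "pd ?B" using pd by (simp add: pd_rotated)
  then have symB: "transpose ?B = ?B" by (simp add: pd_def)
  have BS: "?B ** S = mat 1" unfolding S_def by (rule pd_matrix_inv(1)[OF pdB])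
  have symS: "transpose S = S" by (rule symmetric_inverse[OF symB BS])
  have nnB: "0 \<le> y \<bullet> (?B *v y)" for y using pdB by (cases "y = 0") (auto simp: pd_def less_imp_le)
  have symX: "transpose (\<gamma>\<^sup>2 *\<^sub>R S) = \<gamma>\<^sup>2 *\<^sub>R S" using symS by (simp add: transpose_scalar scalar_mult_eq_scaleR)
  obtain X11 X12 X22 where X: "\<gamma>\<^sup>2 *\<^sub>R S = sym_block X11 X12 X22" using sym_block_exists[OF symX] .
  have tight: "0 \<le> x \<bullet> (sym_block X11 X12 X22 *v x) + 2 * \<gamma> * (x \<bullet> q) + q \<bullet> (?B *v q)" for x q
    unfolding X[symmetric] by (rule schur_tight[OF BS nnB symB])
  have psdX: "psd (sym_block X11 X12 X22)"
    using symX tight[of _ 0] by (simp add: psd_def X)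
  have symX': "transpose (sym_block X11 X12 X22) = sym_block X11 X12 X22" using symX by (simp add: X)
  have "causal Y" unfolding Y_def
    by (intro causal_diff causal_mult causal_M \<gamma> causal_Th causal_Uh E causal_part_causal)
  then have "(Y, \<gamma>, X11, X12, X22) \<in> sdp_feasible W P M"
    using \<gamma> psdX pd tight
    by (simp add: sdp_feasible_def pd_constraint_iff[OF \<gamma> Y] lmi_constraint_iff[OF \<gamma> Y symX'])
  moreover have "sdp_objective r (Y, \<gamma>, X11, X12, X22) = dual_value (excess_cost F G L E) r \<gamma>"
    unfolding objective_eq dual_value_congruence[OF rotation_orthogonal pd, symmetric] X[symmetric]
    by (simp add: dual_value_def S_def trace_def sum_distrib_left)
  ultimately show ?thesis using that by blast
qed

end

theorem mainTheorem1:
  fixes A :: "real^'n^'n" and B :: "real^'m::{finite,linorder}^'n" and C :: "real^'n^'p"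
    and Q Qh :: "real^('t::{finite,linorder} \<times> 'n::finite)^('t \<times> 'n)"
    and R Rh :: "real^('t \<times> 'm)^('t \<times> 'm)"
    and F :: "real^('t \<times> 'm)^('t \<times> 'n)"
    and G :: "real^('t \<times> 'n)^('t \<times> 'n)"
    and J :: "real^('t \<times> 'm)^('t \<times> 'p::finite)"
    and L :: "real^('t \<times> 'n)^('t \<times> 'p)"
    and Th :: "real^('t \<times> 'm)^('t \<times> 'm)"
    and Uh :: "real^('t \<times> 'p)^('t \<times> 'p)"
    and Vh :: "real^('t \<times> 'n)^('t \<times> 'n)"
    and W :: "real^('t \<times> 'p)^('t \<times> 'm)"
    and P :: "real^('t \<times> 'm)^('t \<times> 'n)"
    and M :: "real \<Rightarrow> real^('t \<times> 'm)^('t \<times> 'm)"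
    and r :: real
    and \<mu>0 :: "(real^(('t \<times> 'n) + ('t \<times> 'p))) measure"
  assumes "pd Q" and "transpose Qh ** Qh = Q"
    and "pd R" and "transpose Rh ** Rh = R"
    and "normalized_operators A B C Qh Rh F G J L"
    and "strictly_causal F" and "block_toeplitz F"
    and "strictly_causal G" and "block_toeplitz G"
    and "strictly_causal J" and "block_toeplitz J"
    and "strictly_causal L" and "block_toeplitz L"
    and "causal Th" and "mat 1 + transpose F ** F = transpose Th ** Th"
    and "causal Uh" and "mat 1 + L ** transpose L = Uh ** transpose Uh"
    and "causal Vh" and "mat 1 + transpose L ** L = transpose Vh ** Vh"
    and "W = - (matrix_inv (transpose Th) ** transpose F ** G ** transpose L **
                matrix_inv (transpose Uh))"
    and "P = matrix_inv (transpose Vh) ** transpose G ** F ** matrix_inv Th"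
    and "\<And>\<gamma>. \<gamma> > 0 \<Longrightarrow>
           lower_triangular (M \<gamma>) \<and> (\<forall>i. M \<gamma> $ i $ i > 0) \<and>
           transpose (M \<gamma>) ** M \<gamma> = mat (1 / \<gamma>) + (1 / \<gamma>\<^sup>2) *\<^sub>R (transpose P ** P)"
    and "r > 0"
    and "prob_space \<mu>0" and "sets \<mu>0 = sets borel" and "absolutely_continuous lborel \<mu>0"
    and "has_bochner_integral \<mu>0 (\<lambda>z. \<chi> i j. z $ i * z $ j) (mat 1)"
  shows
    "(INF K\<in>{K. causal K}. worst_case_regret F G J L \<mu>0 r K) =
       (INF s\<in>sdp_feasible W P M. ereal (sdp_objective r s)) \<and>
     (\<forall>Y \<gamma> X11 X12 X22.
        (Y, \<gamma>, X11, X12, X22) \<in> sdp_feasible W P M \<and>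
        (\<forall>s\<in>sdp_feasible W P M. sdp_objective r (Y, \<gamma>, X11, X12, X22) \<le> sdp_objective r s) \<longrightarrow>
        (let E = matrix_inv Th ** matrix_inv (M \<gamma>) ** (Y + causal_part (M \<gamma> ** W)) **
                 matrix_inv Uh;
             K = E_to_K J E
         in causal K \<and>
            worst_case_regret F G J L \<mu>0 r K =
              (INF K'\<in>{K'. causal K'}. worst_case_regret F G J L \<mu>0 r K')))"
proof -
  interpret regret_synthesis F G L Th Uh Vh W P M
    by unfold_locales (use assms lower_triangular_imp_causal in blast)+
  note J = \<open>strictly_causal J\<close>
  let ?wc = "worst_case_regret F G J L \<mu>0 r" and ?C = "excess_cost F G L"
  let ?val = "INF K\<in>{K. causal K}. ?wc K"
  let ?sdp = "INF s\<in>sdp_feasible W P M. ereal (sdp_objective r s)"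
  have wc: "?wc K = (INF \<gamma>\<in>{\<gamma>. \<gamma> > 0 \<and> pd (mat \<gamma> - ?C (K_to_E J K))}.
      ereal (dual_value (?C (K_to_E J K)) r \<gamma>))" for K
    unfolding worst_case_regret_def regret_excess_cost
    by (rule strong_duality) (use assms in \<open>simp_all add: excess_cost_symmetric trace_excess_nonneg\<close>)
  have realize: "causal (E_to_K J E) \<and> ?wc (E_to_K J E) \<le> ereal (sdp_objective r (Y, \<gamma>, X11, X12, X22))"
    if feas: "(Y, \<gamma>, X11, X12, X22) \<in> sdp_feasible W P M"
      and E_def: "E = matrix_inv Th ** matrix_inv (M \<gamma>) ** (Y + causal_part (M \<gamma> ** W)) ** matrix_inv Uh"
    for Y \<gamma> X11 X12 X22 E
  proof
    note E = feasible_point_bounds_dual[OF feas, folded E_def]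
    show "causal (E_to_K J E)" by (rule E_to_K_causal(1)[OF J E(1)])
    have "?wc (E_to_K J E) \<le> ereal (dual_value (?C E) r \<gamma>)"
      unfolding wc E_to_K_causal(2)[OF J E(1)] using E(2,3) by (intro INF_lower) simp
    also have "\<dots> \<le> ereal (sdp_objective r (Y, \<gamma>, X11, X12, X22))" using E(4) by simp
    finally show "?wc (E_to_K J E) \<le> \<dots>" .
  qed
  have "?val \<le> ?sdp"
  proof (rule INF_greatest)
    fix s assume "s \<in> sdp_feasible W P M"
    then obtain Y \<gamma> X11 X12 X22 where s: "s = (Y, \<gamma>, X11, X12, X22)" "(Y, \<gamma>, X11, X12, X22) \<in> sdp_feasible W P M"
      by (cases s) auto
    from realize[OF s(2) refl] show "?val \<le> ereal (sdp_objective r s)"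
      unfolding s(1) by (intro INF_lower2) auto
  qed
  moreover have "?sdp \<le> ?val"
  proof (rule INF_greatest)
    fix K :: "real^('t \<times> 'p)^('t \<times> 'm)" assume "K \<in> {K. causal K}"
    then have E: "causal (K_to_E J K)" using K_to_E_causal[OF J] by simp
    show "?sdp \<le> ?wc K" unfolding wc
    proof (rule INF_greatest)
      fix \<gamma> assume "\<gamma> \<in> {\<gamma>. \<gamma> > 0 \<and> pd (mat \<gamma> - ?C (K_to_E J K))}"
      then obtain s where "s \<in> sdp_feasible W P M" "sdp_objective r s = dual_value (?C (K_to_E J K)) r \<gamma>"
        using dual_value_attained[OF E] by blast
      then show "?sdp \<le> ereal (dual_value (?C (K_to_E J K)) r \<gamma>)" by (metis INF_lower)
    qed
  qed
  ultimately have eq: "?val = ?sdp" by (rule antisym)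
  show ?thesis
  proof (intro conjI allI impI)
    show "?val = ?sdp" by (rule eq)
    fix Y \<gamma> X11 X12 X22
    assume opt: "(Y, \<gamma>, X11, X12, X22) \<in> sdp_feasible W P M \<and>
      (\<forall>s\<in>sdp_feasible W P M. sdp_objective r (Y, \<gamma>, X11, X12, X22) \<le> sdp_objective r s)"
    define E where "E = matrix_inv Th ** matrix_inv (M \<gamma>) ** (Y + causal_part (M \<gamma> ** W)) ** matrix_inv Uh"
    have K: "causal (E_to_K J E)" "?wc (E_to_K J E) \<le> ereal (sdp_objective r (Y, \<gamma>, X11, X12, X22))"
      using realize[OF _ E_def] opt by auto
    have "ereal (sdp_objective r (Y, \<gamma>, X11, X12, X22)) \<le> ?sdp"
      using opt by (intro INF_greatest) simp
    with K eq have "?wc (E_to_K J E) \<le> ?val" by simp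
    moreover have "?val \<le> ?wc (E_to_K J E)" using K by (intro INF_lower) simp
    ultimately have "?wc (E_to_K J E) = ?val" by (rule antisym)
    with K(1) show "let E = matrix_inv Th ** matrix_inv (M \<gamma>) ** (Y + causal_part (M \<gamma> ** W)) ** matrix_inv Uh;
             K = E_to_K J E
         in causal K \<and> ?wc K = (INF K'\<in>{K'. causal K'}. ?wc K')"
      by (simp add: Let_def E_def)
  qed
qed

end
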